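(* Let $\varphi:\mathcal{W}_1([0,1])\to\mathcal{W}_1([0,1])$ be an isometric embedding, that is, $d_{\mathcal{W}_1}(\varphi(\mu),\varphi(\nu))=d_{\mathcal{W}_1}(\mu,\nu)$ for all $\mu,\nu\in\mathcal{W}_1([0,1])$ (surjectivity is not assumed). Then $\varphi\in\{\mathrm{id}_{\mathcal{W}_1([0,1])},\, r_\#,\, j,\, r_\# j\}$, where $r_\# j=j r_\#$. Consequently, every isometric embedding of $\mathcal{W}_1([0,1])$ is surjective, that is, $\mathrm{IsEmb}(\mathcal{W}_1([0,1]))=\mathrm{Isom}(\mathcal{W}_1([0,1]))$. Moreover, this isometry group is isomorphic to the Klein group $C_2\times C_2$.
   Context: $\mathcal{W}_1([0,1])$ is the set of all Borel probability measures on $[0,1]$ with the $1$-Wasserstein distance $d_{\mathcal{W}_1}(\mu,\nu)=\inf_{\pi}\int |x-y|\,d\pi(x,y)$, the infimum being over all couplings $\pi$ of $\mu$ and $\nu$. An isometric embedding of a metric space is a distance preserving self-map; an isometry is a surjective isometric embedding; $\mathrm{IsEmb}$ and $\mathrm{Isom}$ denote the semigroup of isometric embeddings and the group of isometries. $C_2$ is the two-element group. For $\mu\in\mathcal{W}_1([0,1])$ the cumulative distribution function is $F_\mu:[0,1]\to[0,1]$, $F_\mu(x)=\mu([0,x])$; the quantile function $F_\mu^{-1}:[0,1]\to[0,1]$ is given by $F_\mu^{-1}(y)=\sup\{x\in\mathbb{R}\mid \mu((-\infty,x])\le y\}$ for $y\in(0,1)$ (with $\mu$ regarded as a measure on $\mathbb{R}$),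 is defined by right-continuity at $0$, and takes the value $1$ at $1$. The function $F_\mu^{-1}$ is again the cumulative distribution function of a Borel probability measure on $[0,1]$. The reflection $r_\#$ is the push-forward map induced by $r:[0,1]\to[0,1]$, $r(x)=1-x$, i.e. $(r_\#\mu)(A)=\mu(r^{-1}[A])$. The flip operation $j:\mathcal{W}_1([0,1])\to\mathcal{W}_1([0,1])$ is defined by $F_{j(\mu)}=F_\mu^{-1}$. Products of maps denote composition. *)

theory Defs
  imports "HOL-Probability.Probability" "HOL-Algebra.Elementary_Groups"
begin

abbreviation unit_borel :: "real measure" where
  "unit_borel \<equiv> restrict_space borel {0..1}"

typedef W1 = "space (prob_algebra unit_borel)"
  morphisms measure_of_W1 W1_of_measure
proof -
  have "return unit_borel 0 \<in> space (prob_algebra unit_borel)"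
    by (auto simp: space_prob_algebra space_restrict_space intro!: prob_space_return)
  then show ?thesis by blast
qed

definition couplings :: "W1 \<Rightarrow> W1 \<Rightarrow> (real \<times> real) measure set" where
  "couplings \<mu> \<nu> = {\<pi> \<in> space (prob_algebra (unit_borel \<Otimes>\<^sub>M unit_borel)).
     distr \<pi> unit_borel fst = measure_of_W1 \<mu> \<and> distr \<pi> unit_borel snd = measure_of_W1 \<nu>}"

definition W1_dist :: "W1 \<Rightarrow> W1 \<Rightarrow> real" where
  "W1_dist \<mu> \<nu> = (INF \<pi>\<in>couplings \<mu> \<nu>. \<integral>(x, y). \<bar>x - y\<bar> \<partial>\<pi>)"

text \<open>\<open>W1_cdf \<mu>\<close> and \<open>W1_quantile \<mu>\<close> are only meaningful as functions on \<open>[0,1]\<close>.\<close>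

definition W1_cdf :: "W1 \<Rightarrow> real \<Rightarrow> real" where
  "W1_cdf \<mu> x = measure (measure_of_W1 \<mu>) {0..x}"

text \<open>The measure \<open>distr _ borel (\<lambda>x. x)\<close> is \<open>\<mu>\<close> regarded as a measure on the whole real line,
  and \<open>cdf M x\<close> is \<open>M ((-\<infinity>, x])\<close>; the supremum therefore ranges over all real \<open>x\<close>.\<close>

definition W1_quantile :: "W1 \<Rightarrow> real \<Rightarrow> real" where
  "W1_quantile \<mu> y =
     (let q = (\<lambda>y. Sup {x. cdf (distr (measure_of_W1 \<mu>) borel (\<lambda>x. x)) x \<le> y})
      in if y = 1 then 1 else if y = 0 then Lim (at_right 0) q else q y)"

definition reflection :: "W1 \<Rightarrow> W1" where
  "reflection \<mu> = W1_of_measure (distr (measure_of_W1 \<mu>) unit_borel (\<lambda>x. 1 - x))"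

definition flip :: "W1 \<Rightarrow> W1" where
  "flip \<mu> = (THE \<nu>. \<forall>y\<in>{0..1}. W1_cdf \<nu> y = W1_quantile \<mu> y)"

text \<open>Isometries are self-maps of the whole type on which \<open>d\<close> lives; \<open>d\<close> need not be a metric here.\<close>

definition IsEmb :: "('a \<Rightarrow> 'a \<Rightarrow> real) \<Rightarrow> ('a \<Rightarrow> 'a) set" where
  "IsEmb d = {f. \<forall>x y. d (f x) (f y) = d x y}"

definition Isom :: "('a \<Rightarrow> 'a \<Rightarrow> real) \<Rightarrow> ('a \<Rightarrow> 'a) set" where
  "Isom d = {f \<in> IsEmb d. surj f}"

definition isometry_group :: "('a \<Rightarrow> 'a \<Rightarrow> real) \<Rightarrow> ('a \<Rightarrow> 'a) monoid" where
  "isometry_group d = \<lparr>carrier = Isom d, mult = (\<circ>), one = id\<rparr>"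

abbreviation C2 :: "int monoid" where
  "C2 \<equiv> integer_mod_group 2"

lemma W1_prob: "prob_space (measure_of_W1 \<mu>)" "sets (measure_of_W1 \<mu>) = sets unit_borel"
  "space (measure_of_W1 \<mu>) = {0..1}"
proof -
  have "measure_of_W1 \<mu> \<in> space (prob_algebra unit_borel)" by (rule measure_of_W1)
  then show "prob_space (measure_of_W1 \<mu>)" and s: "sets (measure_of_W1 \<mu>) = sets unit_borel"
    by (auto simp: space_prob_algebra)
  from sets_eq_imp_space_eq[OF s] show "space (measure_of_W1 \<mu>) = {0..1}"
    by (simp add: space_restrict_space)
qed

lemma measurable_W1: "f \<in> measurable (measure_of_W1 \<mu>) M \<longleftrightarrow> f \<in> measurable unit_borel M"
  by (simp only: measurable_cong_sets[OF W1_prob(2) refl])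

lemma measure_of_reflection:
  "measure_of_W1 (reflection \<mu>) = distr (measure_of_W1 \<mu>) unit_borel (\<lambda>x. 1 - x)"
proof -
  have "(\<lambda>x. 1 - x) \<in> measurable (measure_of_W1 \<mu>) unit_borel"
    unfolding measurable_W1
    by (rule measurable_restrict_space3) auto
  then have "distr (measure_of_W1 \<mu>) unit_borel (\<lambda>x. 1 - x) \<in> space (prob_algebra unit_borel)"
    by (auto simp: space_prob_algebra intro!: prob_space.prob_space_distr W1_prob)
  then show ?thesis
    unfolding reflection_def by (rule W1_of_measure_inverse)
qed

abbreviation (input) line_measure :: "W1 \<Rightarrow> real measure" where
  "line_measure \<mu> \<equiv> distr (measure_of_W1 \<mu>) borel (\<lambda>x. x)"

lemma id_measurable_W1: "(\<lambda>x. x) \<in> measurable (measure_of_W1 \<mu>) borel"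
  unfolding measurable_W1 by (rule measurable_restrict_space1) simp

lemma real_distribution_line: "real_distribution (line_measure \<mu>)"
  by (intro real_distribution.intro prob_space.prob_space_distr W1_prob id_measurable_W1
      real_distribution_axioms.intro) auto

lemma cdf_line: "cdf (line_measure \<mu>) x = measure (measure_of_W1 \<mu>) ({..x} \<inter> {0..1})"
  by (simp add: cdf_def measure_distr id_measurable_W1 W1_prob)

lemma cdf_line_eq: "cdf (line_measure \<mu>) x = W1_cdf \<mu> x" if "x \<in> {0..1}"
proof -
  have "{..x} \<inter> {0..1} = {0..x}" using that by auto
  then show ?thesis unfolding cdf_line W1_cdf_def by (rule arg_cong)
qed

lemma cdf_line_lt: "cdf (line_measure \<mu>) x = 0" if "x < 0"
proof -
  have "{..x} \<inter> {0..1} = {}" using that by auto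
  then show ?thesis by (simp add: cdf_line)
qed

lemma cdf_line_ge: "cdf (line_measure \<mu>) x = 1" if "x \<ge> 1"
proof -
  have "{..x} \<inter> {0..1} = space (measure_of_W1 \<mu>)" using that by (auto simp: W1_prob)
  then show ?thesis by (simp only: cdf_line prob_space.prob_space[OF W1_prob(1)])
qed

lemma W1_eqI:
  assumes "\<And>y. y \<in> {0..1} \<Longrightarrow> W1_cdf \<mu> y = W1_cdf \<nu> y"
  shows "\<mu> = \<nu>"
proof -
  have "cdf (line_measure \<mu>) x = cdf (line_measure \<nu>) x" for x
    by (cases "x < 0"; cases "x > 1") (auto simp: cdf_line_lt cdf_line_ge cdf_line_eq assms)
  then have eq: "line_measure \<mu> = line_measure \<nu>"
    by (intro cdf_unique real_distribution_line ext)
  have em: "emeasure (measure_of_W1 \<rho>) A = emeasure (line_measure \<rho>) A"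
    if "A \<in> sets unit_borel" for A \<rho>
  proof -
    have "A \<subseteq> {0..1}" "A \<in> sets borel" using that by (auto simp: sets_restrict_space)
    then show ?thesis
      by (simp add: emeasure_distr id_measurable_W1 W1_prob Int_absorb2)
  qed
  have "measure_of_W1 \<mu> = measure_of_W1 \<nu>"
    by (rule measure_eqI) (auto simp: W1_prob em eq)
  then show ?thesis by (simp add: measure_of_W1_inject)
qed

lemma W1_quantile_is_cdf: "\<exists>\<nu>. \<forall>y\<in>{0..1}. W1_cdf \<nu> y = W1_quantile \<mu> y"
proof -
  let ?G = "cdf (line_measure \<mu>)"
  interpret L: real_distribution "line_measure \<mu>" by (rule real_distribution_line)
  have G_mono: "mono ?G" by (auto intro!: monoI L.cdf_nondecreasing)
  have [measurable]: "?G \<in> borel_measurable borel" by (rule borel_measurable_mono[OF G_mono])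
  have G01: "?G x \<in> {0..1}" for x by (auto simp: L.cdf_nonneg L.cdf_bounded_prob)
  let ?U = "restrict_space lborel {0..1::real}"
  have "prob_space ?U"
    by (rule prob_spaceI) (simp add: space_restrict_space emeasure_restrict_space)
  have meas: "?G \<in> measurable ?U unit_borel"
    by (intro measurable_restrict_space2 measurable_restrict_space1) (use G01 in auto)
  define N where "N = distr ?U unit_borel ?G"
  have "N \<in> space (prob_algebra unit_borel)"
    unfolding N_def
    by (auto simp: space_prob_algebra intro!: prob_space.prob_space_distr \<open>prob_space ?U\<close> meas)
  define \<nu> where "\<nu> = W1_of_measure N"
  have \<nu>: "measure_of_W1 \<nu> = N"
    unfolding \<nu>_def by (rule W1_of_measure_inverse) fact
  have cdf\<nu>: "W1_cdf \<nu> y = measure lborel {t\<in>{0..1}. ?G t \<le> y}" if "y \<in> {0..1}" for y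
  proof -
    have "{0..y} \<in> sets unit_borel"
      using that by (auto simp: sets_restrict_space image_iff intro!: bexI[of _ "{0..y}"])
    then have "measure N {0..y} = measure ?U (?G -` {0..y} \<inter> space ?U)"
      unfolding N_def by (rule measure_distr[OF meas])
    also have "?G -` {0..y} \<inter> space ?U = {t\<in>{0..1}. ?G t \<le> y}"
      using G01 by (auto simp: space_restrict_space)
    also have "measure ?U {t\<in>{0..1}. ?G t \<le> y} = measure lborel {t\<in>{0..1}. ?G t \<le> y}"
      by (rule measure_restrict_space) auto
    finally show ?thesis by (simp add: W1_cdf_def \<nu>)
  qed
  let ?q = "\<lambda>y. Sup {x. ?G x \<le> y}"
  have inner: "W1_cdf \<nu> y = ?q y" if y: "y \<in> {0<..<1}" for y
  proof -
    have up: "x < 1" if "?G x \<le> y" for x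
      using that y cdf_line_ge[of x \<mu>] by (cases "x < 1") auto
    then have bdd: "bdd_above {x. ?G x \<le> y}" by (auto intro!: bdd_aboveI[of _ 1] less_imp_le)
    have neg: "?G x \<le> y" if "x < 0" for x using that y by (simp add: cdf_line_lt)
    then have ne: "{x. ?G x \<le> y} \<noteq> {}" by (auto intro!: exI[of _ "-1"])
    have q1: "?q y \<le> 1" by (rule cSup_least[OF ne]) (auto dest: up)
    have q0: "0 \<le> ?q y"
    proof (rule dense_le)
      fix z :: real assume "z < 0"
      then show "z \<le> ?q y" by (auto intro!: cSup_upper bdd neg)
    qed
    let ?A = "{t\<in>{0..1}. ?G t \<le> y}"
    have A1: "?A \<subseteq> {0..?q y}" by (auto intro!: cSup_upper bdd)
    have A2: "{0..<?q y} \<subseteq> ?A"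
    proof
      fix t assume t: "t \<in> {0..<?q y}"
      then obtain x where "?G x \<le> y" "t < x"
        using less_cSup_iff[OF ne bdd] by auto
      then show "t \<in> ?A" using t q1 monoD[OF G_mono, of t x] by auto
    qed
    have "?A \<in> sets lborel" by simp
    have "measure lborel ?A \<le> measure lborel {0..?q y}"
      by (rule measure_mono_fmeasurable[OF A1]) (auto simp: fmeasurable_def q0)
    moreover have "measure lborel {0..<?q y} \<le> measure lborel ?A"
    proof (rule measure_mono_fmeasurable[OF A2])
      have "{0..?q y} \<in> fmeasurable lborel" by (auto simp: fmeasurable_def q0)
      then show "?A \<in> fmeasurable lborel" by (rule fmeasurableI2[OF _ A1]) simp
    qed auto
    ultimately have "measure lborel ?A = ?q y" using q0 by simp
    then show ?thesis using cdf\<nu>[of y] y by simp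
  qed
  have one: "W1_cdf \<nu> 1 = 1"
    using cdf_line_ge[of 1 \<nu>] cdf_line_eq[of 1 \<nu>] by simp
  have zero: "Lim (at_right 0) ?q = W1_cdf \<nu> 0"
  proof (rule tendsto_Lim)
    interpret K: real_distribution "line_measure \<nu>" by (rule real_distribution_line)
    have "(cdf (line_measure \<nu>) \<longlongrightarrow> cdf (line_measure \<nu>) 0) (at_right 0)"
      using K.cdf_is_right_cont[of 0] by (simp add: continuous_within)
    moreover have "\<forall>\<^sub>F y in at_right 0. cdf (line_measure \<nu>) y = ?q y"
      unfolding eventually_at_right_field
      by (rule exI[of _ 1]) (auto simp: cdf_line_eq inner)
    ultimately show "(?q \<longlongrightarrow> W1_cdf \<nu> 0) (at_right 0)"
      by (simp add: cdf_line_eq tendsto_cong)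
  qed simp
  have "W1_cdf \<nu> y = W1_quantile \<mu> y" if "y \<in> {0..1}" for y
    using that inner[of y] one zero by (auto simp: W1_quantile_def Let_def)
  then show ?thesis by blast
qed

lemma W1_cdf_flip: "W1_cdf (flip \<mu>) y = W1_quantile \<mu> y" if "y \<in> {0..1}"
proof -
  have "\<exists>!\<nu>. \<forall>y\<in>{0..1}. W1_cdf \<nu> y = W1_quantile \<mu> y"
    using W1_quantile_is_cdf[of \<mu>] by (auto intro!: W1_eqI)
  from theI'[OF this] that show ?thesis unfolding flip_def by blast
qed

lemma couplings_nonempty: "couplings \<mu> \<nu> \<noteq> {}"
proof -
  let ?M = "measure_of_W1 \<mu>" and ?N = "measure_of_W1 \<nu>"
  interpret M: prob_space ?M by (rule W1_prob)
  interpret N: prob_space ?N by (rule W1_prob)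
  interpret pair_prob_space ?M ?N ..
  have s: "sets (?M \<Otimes>\<^sub>M ?N) = sets (unit_borel \<Otimes>\<^sub>M unit_borel)"
    by (intro sets_pair_measure_cong W1_prob)
  have "distr (?M \<Otimes>\<^sub>M ?N) unit_borel fst = distr (?M \<Otimes>\<^sub>M ?N) ?M fst"
    by (rule distr_cong) (auto simp: W1_prob)
  also have "\<dots> = ?M" by (rule N.distr_pair_fst)
  finally have 1: "distr (?M \<Otimes>\<^sub>M ?N) unit_borel fst = ?M" .
  have 2: "distr (?M \<Otimes>\<^sub>M ?N) unit_borel snd = ?N"
  proof (rule measure_eqI)
    fix A assume A: "A \<in> sets (distr (?M \<Otimes>\<^sub>M ?N) unit_borel snd)"
    then have A': "A \<in> sets ?N" by (simp add: W1_prob)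
    have "snd \<in> measurable (?M \<Otimes>\<^sub>M ?N) unit_borel"
      using measurable_snd[of ?M ?N] by (simp add: measurable_cong_sets[OF refl W1_prob(2)])
    then have "emeasure (distr (?M \<Otimes>\<^sub>M ?N) unit_borel snd) A
        = emeasure (?M \<Otimes>\<^sub>M ?N) (snd -` A \<inter> space (?M \<Otimes>\<^sub>M ?N))"
      using A by (simp add: emeasure_distr)
    also have "snd -` A \<inter> space (?M \<Otimes>\<^sub>M ?N) = space ?M \<times> A"
      using sets.sets_into_space[OF A'] by (auto simp: space_pair_measure)
    also have "emeasure (?M \<Otimes>\<^sub>M ?N) (space ?M \<times> A) = emeasure ?N A"
      using A' by (simp add: N.emeasure_pair_measure_Times M.emeasure_space_1)
    finally show "emeasure (distr (?M \<Otimes>\<^sub>M ?N) unit_borel snd) A = emeasure ?N A" .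
  qed (simp add: W1_prob)
  have "?M \<Otimes>\<^sub>M ?N \<in> couplings \<mu> \<nu>"
    unfolding couplings_def space_prob_algebra using s 1 2 prob_space_axioms by simp
  then show ?thesis by blast
qed

lemma integrable_coupling:
  assumes "\<pi> \<in> couplings \<mu> \<nu>"
  shows "integrable \<pi> (\<lambda>(x, y). \<bar>x - y\<bar>)"
proof -
  from assms have p: "prob_space \<pi>" and s: "sets \<pi> = sets (unit_borel \<Otimes>\<^sub>M unit_borel)"
    by (auto simp: couplings_def space_prob_algebra)
  interpret prob_space \<pi> by (rule p)
  have sp: "space \<pi> = {0..1} \<times> {0..1}"
    using sets_eq_imp_space_eq[OF s] by (simp add: space_pair_measure space_restrict_space)
  have [measurable]: "(\<lambda>x. x) \<in> measurable unit_borel borel"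
    by (rule measurable_restrict_space1) simp
  have "(\<lambda>(x, y). \<bar>x - y\<bar>) \<in> borel_measurable (unit_borel \<Otimes>\<^sub>M unit_borel)"
    unfolding case_prod_beta
    by (intro borel_measurable_abs borel_measurable_diff
        measurable_compose[OF measurable_fst] measurable_compose[OF measurable_snd]) measurable
  then have "(\<lambda>(x, y). \<bar>x - y\<bar>) \<in> borel_measurable \<pi>"
    by (simp add: measurable_cong_sets[OF s refl])
  then show ?thesis
    by (intro integrable_const_bound[where B = 1] AE_I2) (auto simp: sp abs_if)
qed

end

theory Submission
  imports Defs
begin

text \<open>
  \<open>W1_dist \<mu> \<nu>\<close> is the \<open>L\<^sup>1\<close> distance of the distribution functions \<open>F\<close>, \<open>G\<close> of \<open>\<mu>\<close>, \<open>\<nu>\<close>,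
  which equals \<open>\<integral>F + \<integral>G - 2 \<integral>min F G\<close>. The only pair at distance \<open>1\<close> consists of the Dirac masses at
  \<open>0\<close> and \<open>1\<close>, so up to reflection an isometric embedding fixes both; it then preserves \<open>\<integral>F\<close> and
  \<open>\<integral>min F G\<close>. Since \<open>min F G \<ge> F G\<close> and, by Chebyshev, \<open>\<integral>F G \<ge> \<integral>F \<integral>G\<close>, the value
  \<open>\<integral>min F G\<close> is minimal, for given values of \<open>\<integral>F\<close> and \<open>\<integral>G\<close> in \<open>(0,1)\<close>, exactly when
  one of the measures is a Dirac mass \<open>dirac t\<close> and the other a combination of Dirac masses at the
  endpoints, which is a \<open>flip (dirac c)\<close>.
  Hence these two families are preserved or exchanged, all members at once. Up to
  \<open>reflection \<circ> flip\<close>, every Dirac mass is fixed, and the distances to all Dirac masses determine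
  a measure.\<close>

section \<open>Distribution functions and the flip\<close>

abbreviation unit_lborel :: "real measure" where
  "unit_lborel \<equiv> restrict_space lborel {0..1}"

text \<open>Extending the distribution function to the whole line, by 0 on the left and 1 on the
  right, makes it increasing and right-continuous everywhere. On [0,1] it agrees with
  \<open>W1_cdf\<close>.\<close>

definition line_cdf :: "W1 \<Rightarrow> real \<Rightarrow> real" where
  "line_cdf \<mu> = cdf (distr (measure_of_W1 \<mu>) borel (\<lambda>x. x))"

lemma space_unit_lborel: "space unit_lborel = {0..1}"
  by (simp add: space_restrict_space)

lemma prob_space_unit_lborel: "prob_space unit_lborel"
  by (rule prob_spaceI) (simp add: space_restrict_space emeasure_restrict_space)

interpretation U: prob_space unit_lborel
  by (rule prob_space_unit_lborel)

lemma sets_unit_lborelI: "A \<in> sets borel \<Longrightarrow> A \<subseteq> {0..1} \<Longrightarrow> A \<in> sets unit_lborel"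
  by (simp add: sets_restrict_space_iff)

lemma measurable_unit_lborel: "f \<in> measurable borel M \<Longrightarrow> f \<in> measurable unit_lborel M"
  by (rule measurable_restrict_space1) simp

lemma measure_unit_lborel:
  assumes "0 \<le> a" "a \<le> b" "b \<le> 1"
  shows "measure unit_lborel {a..b} = b - a" "measure unit_lborel {a..<b} = b - a"
    "measure unit_lborel {a<..b} = b - a"
proof -
  have "{a..b} \<subseteq> {0..1}" "{a..<b} \<subseteq> {0..1}" "{a<..b} \<subseteq> {0..1}"
    using assms by auto
  with assms show "measure unit_lborel {a..b} = b - a" "measure unit_lborel {a..<b} = b - a"
    "measure unit_lborel {a<..b} = b - a"
    by (simp_all add: measure_restrict_space)
qed

lemma prob_unit_interval [simp]: "U.prob {0..1} = 1"
  using U.prob_space by (simp add: space_unit_lborel)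

lemma integrable_unit_lborel:
  fixes f :: "real \<Rightarrow> real"
  assumes "f \<in> borel_measurable borel" "\<And>x. x \<in> {0..1} \<Longrightarrow> \<bar>f x\<bar> \<le> B"
  shows "integrable unit_lborel f"
  by (rule U.integrable_const_bound[where B = B])
    (auto intro!: AE_I2 measurable_unit_lborel assms simp: space_unit_lborel)

lemma line_cdf_mono: "x \<le> y \<Longrightarrow> line_cdf \<mu> x \<le> line_cdf \<mu> y"
  unfolding line_cdf_def
  by (rule finite_borel_measure.cdf_nondecreasing)
    (rule real_distribution.finite_borel_measure_M[OF real_distribution_line])

lemma line_cdf_nonneg [simp]: "0 \<le> line_cdf \<mu> x"
  by (simp add: line_cdf_def cdf_def)

lemma line_cdf_le_1 [simp]: "line_cdf \<mu> x \<le> 1"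
  unfolding line_cdf_def
  by (rule real_distribution.cdf_bounded_prob[OF real_distribution_line])

lemma abs_line_cdf_diff_le_1 [simp]: "\<bar>line_cdf \<mu> x - line_cdf \<nu> y\<bar> \<le> 1"
  using line_cdf_nonneg[of \<mu> x] line_cdf_nonneg[of \<nu> y] line_cdf_le_1[of \<mu> x] line_cdf_le_1[of \<nu> y]
  by linarith

lemma line_cdf_eq_1 [simp]: "1 \<le> x \<Longrightarrow> line_cdf \<mu> x = 1"
  unfolding line_cdf_def by (rule cdf_line_ge)

lemma line_cdf_measurable [measurable]: "line_cdf \<mu> \<in> borel_measurable borel"
  by (rule borel_measurable_mono) (auto intro: monoI line_cdf_mono)

lemma line_cdf_right_cont: "(line_cdf \<mu> \<longlongrightarrow> line_cdf \<mu> x) (at_right x)"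
  using finite_borel_measure.cdf_is_right_cont[OF
    real_distribution.finite_borel_measure_M[OF real_distribution_line], of x \<mu>]
  unfolding line_cdf_def by (simp add: continuous_within)

lemma line_cdf_eq_measure: "line_cdf \<mu> x = measure (measure_of_W1 \<mu>) ({..x} \<inter> {0..1})"
  unfolding line_cdf_def by (rule cdf_line)

lemma line_cdf_eq_0 [simp]: "x < 0 \<Longrightarrow> line_cdf \<mu> x = 0"
  unfolding line_cdf_def by (rule cdf_line_lt)

lemma line_cdf_flip:
  assumes "y \<in> {0..1}"
  shows "line_cdf (flip \<mu>) y = W1_quantile \<mu> y"
  unfolding line_cdf_def using W1_cdf_flip[OF assms] cdf_line_eq[OF assms] by simp

text \<open>A nonempty open interval has positive length, so a property that holds almost everywhere
  cannot fail on all of it.\<close>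

lemma AE_unit_lborel_dense:
  assumes "AE x in unit_lborel. P x" "0 \<le> a" "a < b" "b \<le> 1"
  obtains x where "a < x" "x < b" "P x"
proof -
  have "AE x in lborel. x \<in> {0..1} \<longrightarrow> P x"
    using assms(1) by (simp add: AE_restrict_space_iff)
  moreover have "\<not> (AE x in lborel. x \<notin> {a<..<b})"
    using assms(3) by (subst AE_iff_measurable[of "{a<..<b}"]) auto
  moreover have "AE x in lborel. x \<notin> {a<..<b}" if "AE x in lborel. x \<in> {0..1} \<longrightarrow> P x"
    "\<And>x. a < x \<Longrightarrow> x < b \<Longrightarrow> \<not> P x"
    using that(1) by eventually_elim (use that(2) assms in auto)
  ultimately show thesis using that by blast
qed

text \<open>The two endpoints form a null set; this avoids the special values of quantile functions
  at 0 and 1.\<close>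

lemma AE_unit_lborel_interior:
  assumes "\<And>x. 0 < x \<Longrightarrow> x < 1 \<Longrightarrow> P x"
  shows "AE x in unit_lborel. P x"
proof -
  have "AE x in lborel. x \<noteq> (0::real)" "AE x in lborel. x \<noteq> (1::real)"
    by (rule AE_lborel_singleton)+
  then have "AE x in lborel. x \<in> {0..1} \<longrightarrow> P x"
    by eventually_elim (use assms in auto)
  moreover have "{0..1::real} \<inter> space lborel \<in> sets lborel" by simp
  ultimately show ?thesis by (simp only: AE_restrict_space_iff)
qed

text \<open>If \<open>f a\<close> and \<open>g a\<close> differed, right continuity would keep
  \<open>f - g\<close> away from 0 on an interval to the right of \<open>a\<close>, a set of
  positive measure.\<close>

lemma right_cont_eq_of_AE:
  fixes f g :: "real \<Rightarrow> real"
  assumes ae: "AE x in unit_lborel. f x = g x"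
    and f: "(f \<longlongrightarrow> f a) (at_right a)" and g: "(g \<longlongrightarrow> g a) (at_right a)"
    and a: "0 \<le> a" "a < 1"
  shows "f a = g a"
proof (rule ccontr)
  assume "f a \<noteq> g a"
  then have "f a - g a \<noteq> 0" by simp
  have "((\<lambda>x. f x - g x) \<longlongrightarrow> f a - g a) (at_right a)" by (intro tendsto_diff f g)
  from tendsto_imp_eventually_ne[OF this \<open>f a - g a \<noteq> 0\<close>]
  obtain b where b: "b > a" "\<And>x. a < x \<Longrightarrow> x < b \<Longrightarrow> f x - g x \<noteq> 0"
    unfolding eventually_at_right_field by auto
  obtain x where "a < x" "x < min b 1" "f x = g x"
    by (rule AE_unit_lborel_dense[OF ae a(1), of "min b 1"]) (use a b in auto)
  then show False using b(2)[of x] by simp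
qed

lemma W1_eqI_line_cdf:
  assumes "\<And>x. 0 \<le> x \<Longrightarrow> x < 1 \<Longrightarrow> line_cdf \<mu> x = line_cdf \<nu> x"
  shows "\<mu> = \<nu>"
proof (rule W1_eqI)
  fix y :: real assume y: "y \<in> {0..1}"
  have "line_cdf \<mu> y = line_cdf \<nu> y"
    using y assms by (cases "y = 1") auto
  then show "W1_cdf \<mu> y = W1_cdf \<nu> y"
    by (simp add: cdf_line_eq[OF y, symmetric] line_cdf_def)
qed

lemma W1_eqI_AE:
  assumes "AE x in unit_lborel. line_cdf \<mu> x = line_cdf \<nu> x"
  shows "\<mu> = \<nu>"
  by (rule W1_eqI_line_cdf) (rule right_cont_eq_of_AE[OF assms line_cdf_right_cont line_cdf_right_cont])

section \<open>Push-forwards of the uniform distribution\<close>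

lemma measurable_unit_borelI:
  assumes "f \<in> borel_measurable borel" "\<And>x. x \<in> {0..1} \<Longrightarrow> f x \<in> {0..1}"
  shows "f \<in> measurable unit_lborel unit_borel"
  by (intro measurable_restrict_space2 measurable_restrict_space1)
    (use assms in \<open>auto simp: space_restrict_space\<close>)

lemma line_cdf_measurable_unit: "line_cdf \<mu> \<in> measurable unit_lborel unit_borel"
  by (rule measurable_unit_borelI) auto

text \<open>The law of \<open>f\<close> under the uniform distribution on [0,1]; meaningful for
  measurable \<open>f\<close> with values in [0,1].\<close>

definition push_unit :: "(real \<Rightarrow> real) \<Rightarrow> W1" where
  "push_unit f = W1_of_measure (distr unit_lborel unit_borel f)"

lemma measure_of_push_unit:
  assumes "f \<in> measurable unit_lborel unit_borel"
  shows "measure_of_W1 (push_unit f) = distr unit_lborel unit_borel f"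
  unfolding push_unit_def
  by (rule W1_of_measure_inverse)
    (use assms in \<open>auto simp: space_prob_algebra intro!: U.prob_space_distr\<close>)

lemma atMost_unit_borel: "{..y} \<inter> {0..1} \<in> sets unit_borel"
  by (auto simp: sets_restrict_space)

lemma line_cdf_push_unit:
  assumes f: "f \<in> measurable unit_lborel unit_borel"
  shows "line_cdf (push_unit f) y = measure unit_lborel {t\<in>{0..1}. f t \<le> y}"
proof -
  have "f \<in> {0..1} \<rightarrow> {0..1}"
    using measurable_space[OF f] by (auto simp: space_restrict_space)
  then have "f -` ({..y} \<inter> {0..1}) \<inter> space unit_lborel = {t\<in>{0..1}. f t \<le> y}"
    unfolding space_unit_lborel by blast
  then show ?thesis
    unfolding line_cdf_eq_measure measure_of_push_unit[OF f]
    by (simp only: measure_distr[OF f atMost_unit_borel])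
qed

text \<open>The set where \<open>F \<le> y\<close> is an initial segment of [0,1] whose length is
  the quantile at \<open>y\<close>. So \<open>flip\<close> can be handled as a push-forward, without
  suprema.\<close>

lemma flip_eq_push_unit: "flip \<mu> = push_unit (line_cdf \<mu>)"
proof (rule W1_eqI_AE)
  let ?F = "line_cdf \<mu>"
  have "line_cdf (flip \<mu>) y = line_cdf (push_unit ?F) y" if y: "0 < y" "y < 1" for y
  proof -
    let ?A = "{t\<in>{0..1}. ?F t \<le> y}" and ?S = "{x. ?F x \<le> y}"
    have up: "x < 1" if "?F x \<le> y" for x
      using that y by (cases "x < 1") auto
    then have bdd: "bdd_above ?S" by (auto intro!: bdd_aboveI[of _ 1] less_imp_le)
    have ne: "?S \<noteq> {}" using y by (auto intro!: exI[of _ "-1"])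
    have q1: "Sup ?S \<le> 1" by (rule cSup_least[OF ne]) (auto dest: up)
    have q0: "0 \<le> Sup ?S"
    proof (rule dense_le)
      show "z \<le> Sup ?S" if "z < 0" for z
        using that y by (auto intro!: cSup_upper bdd)
    qed
    \<comment> \<open>The supremum need not be attained, so \<open>?A\<close> is squeezed between
      the closed and the half-open interval, which have equal length.\<close>
    have A1: "?A \<subseteq> {0..Sup ?S}" by (auto intro!: cSup_upper bdd)
    have A2: "{0..<Sup ?S} \<subseteq> ?A"
    proof
      fix t assume t: "t \<in> {0..<Sup ?S}"
      then obtain x where "?F x \<le> y" "t < x"
        using less_cSup_iff[OF ne bdd] by auto
      then show "t \<in> ?A" using t q1 line_cdf_mono[of t x \<mu>] by auto
    qed
    have sets: "?A \<in> sets unit_lborel" "{0..Sup ?S} \<in> sets unit_lborel"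
      using q1 by (auto intro!: sets_unit_lborelI)
    have "measure unit_lborel ?A \<le> measure unit_lborel {0..Sup ?S}"
      by (rule U.finite_measure_mono[OF A1 sets(2)])
    moreover have "measure unit_lborel {0..<Sup ?S} \<le> measure unit_lborel ?A"
      by (rule U.finite_measure_mono[OF A2 sets(1)])
    ultimately have "measure unit_lborel ?A = Sup ?S"
      using q0 q1 by (simp add: measure_unit_lborel)
    moreover have "line_cdf (flip \<mu>) y = Sup ?S"
      using y line_cdf_flip[of y \<mu>] by (simp add: W1_quantile_def line_cdf_def[symmetric])
    ultimately show ?thesis
      by (simp add: line_cdf_push_unit[OF line_cdf_measurable_unit])
  qed
  then show "AE y in unit_lborel. line_cdf (flip \<mu>) y = line_cdf (push_unit ?F) y"
    by (rule AE_unit_lborel_interior)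
qed

lemma measure_of_flip: "measure_of_W1 (flip \<mu>) = distr unit_lborel unit_borel (line_cdf \<mu>)"
  by (simp add: flip_eq_push_unit measure_of_push_unit line_cdf_measurable_unit)

lemma line_cdf_flip_eq_measure:
  "line_cdf (flip \<mu>) y = measure unit_lborel {t\<in>{0..1}. line_cdf \<mu> t \<le> y}"
  by (simp add: flip_eq_push_unit line_cdf_push_unit line_cdf_measurable_unit)

text \<open>Inverting a right-continuous increasing function twice gives it back: the
  \<open>u\<close> at which the inverse is at most \<open>x\<close> fill [0, F x] up to possibly its
  right endpoint.\<close>

lemma flip_flip: "flip (flip \<mu>) = \<mu>"
proof (rule W1_eqI_line_cdf)
  fix x :: real assume x: "0 \<le> x" "x < 1"
  let ?F = "line_cdf \<mu>"
  let ?A = "{u\<in>{0..1}. line_cdf (flip \<mu>) u \<le> x}"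
  \<comment> \<open>For \<open>u < F x\<close>, monotonicity confines the sublevel set of
    \<open>F\<close> at \<open>u\<close> to [0, x].\<close>
  have lower: "{0..<?F x} \<subseteq> ?A"
  proof
    fix u assume u: "u \<in> {0..<?F x}"
    have "t \<le> x" if "?F t \<le> u" for t
    proof (rule ccontr)
      assume "\<not> t \<le> x"
      then show False using line_cdf_mono[of x t \<mu>] that u by auto
    qed
    then have "{t\<in>{0..1}. ?F t \<le> u} \<subseteq> {0..x}"
      by auto
    then have "measure unit_lborel {t\<in>{0..1}. ?F t \<le> u} \<le> measure unit_lborel {0..x}"
      by (rule U.finite_measure_mono) (use x in \<open>auto intro!: sets_unit_lborelI\<close>)
    moreover have "u \<le> 1"
      using u line_cdf_le_1[of \<mu> x] by (auto intro: order_trans less_imp_le)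
    ultimately show "u \<in> ?A"
      using u x by (simp add: line_cdf_flip_eq_measure measure_unit_lborel)
  qed
  \<comment> \<open>For \<open>u > F x\<close>, right continuity gives some \<open>z > x\<close>
    with \<open>F z < u\<close>, so the sublevel set at \<open>u\<close> has length greater than
    \<open>x\<close>.\<close>
  have upper: "?A \<subseteq> {0..?F x}"
  proof (rule subsetI, rule ccontr)
    fix u assume u: "u \<in> ?A" "u \<notin> {0..?F x}"
    then have "?F x < u" by auto
    from order_tendstoD(2)[OF line_cdf_right_cont this]
    obtain b where b: "b > x" "\<And>z. x < z \<Longrightarrow> z < b \<Longrightarrow> ?F z < u"
      unfolding eventually_at_right_field by auto
    obtain z where z: "x < z" "z < b" "z \<le> 1" "?F z < u"
      using b x dense[of x "min b 1"] by auto
    have "{0..z} \<subseteq> {t\<in>{0..1}. ?F t \<le> u}"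
      using z line_cdf_mono[of _ z \<mu>] by force
    then have "measure unit_lborel {0..z} \<le> measure unit_lborel {t\<in>{0..1}. ?F t \<le> u}"
      by (rule U.finite_measure_mono)
        (auto intro!: sets_unit_lborelI)
    with z x u(1) show False
      by (simp add: line_cdf_flip_eq_measure measure_unit_lborel)
  qed
  have sets: "?A \<in> sets unit_lborel" "{0..?F x} \<in> sets unit_lborel"
    by (auto intro!: sets_unit_lborelI intro: order_trans[OF _ line_cdf_le_1])
  have "measure unit_lborel ?A \<le> measure unit_lborel {0..?F x}"
    by (rule U.finite_measure_mono[OF upper sets(2)])
  moreover have "measure unit_lborel {0..<?F x} \<le> measure unit_lborel ?A"
    by (rule U.finite_measure_mono[OF lower sets(1)])
  ultimately show "line_cdf (flip (flip \<mu>)) x = ?F x"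
    by (simp add: line_cdf_flip_eq_measure[of "flip \<mu>"] measure_unit_lborel)
qed

section \<open>The Wasserstein distance as the \<open>L\<^sup>1\<close> distance of distribution functions\<close>

text \<open>For nested sets the integrand is the indicator of the larger set minus the smaller one,
  so the absolute value can be taken after integrating.\<close>

lemma (in prob_space) integral_abs_diff_indicator_nested:
  assumes [measurable]: "A \<in> events" "B \<in> events" and nested: "A \<subseteq> B \<or> B \<subseteq> A"
  shows "(\<integral>x. \<bar>indicator A x - indicator B x\<bar> \<partial>M) = \<bar>prob A - prob B\<bar>"
proof -
  have *: "(\<integral>x. \<bar>indicator A x - indicator B x\<bar> \<partial>M) = \<bar>prob A - prob B\<bar>"
    if "A \<subseteq> B" and [measurable]: "A \<in> events" "B \<in> events" for A B
  proof -
    have "\<bar>indicator A x - indicator B x\<bar> = (indicator B x - indicator A x :: real)" for x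
      using that(1) by (auto simp: indicator_def)
    then have "(\<integral>x. \<bar>indicator A x - indicator B x\<bar> \<partial>M) = prob B - prob A"
      by (simp add: Bochner_Integration.integral_diff less_top[symmetric])
    then show ?thesis using finite_measure_mono[OF that(1,3)] by simp
  qed
  show ?thesis
    using nested *[of A B] *[of B A] by (auto simp: abs_minus_commute)
qed

definition cdf_dist :: "W1 \<Rightarrow> W1 \<Rightarrow> real" where
  "cdf_dist \<mu> \<nu> = (\<integral>x. \<bar>line_cdf \<mu> x - line_cdf \<nu> x\<bar> \<partial>unit_lborel)"

lemma line_cdf_flip_eq_measure_space:
  "line_cdf (flip \<mu>) u = U.prob {t\<in>space unit_lborel. line_cdf \<mu> t \<le> u}"
  by (simp add: line_cdf_flip_eq_measure space_unit_lborel)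

text \<open>Sublevel sets of increasing functions are initial segments of \<open>A\<close>, and
  initial segments are comparable.\<close>

lemma sublevel_nested:
  fixes f g :: "real \<Rightarrow> real"
  assumes "mono f" "mono g"
  shows "{t\<in>A. f t \<le> u} \<subseteq> {t\<in>A. g t \<le> u} \<or> {t\<in>A. g t \<le> u} \<subseteq> {t\<in>A. f t \<le> u}"
proof (rule ccontr)
  assume "\<not> ?thesis"
  then obtain s t where st: "f s \<le> u" "\<not> g s \<le> u" "g t \<le> u" "\<not> f t \<le> u" by blast
  then show False
    using monoD[OF assms(1), of t s] monoD[OF assms(2), of s t] by (cases "s \<le> t") auto
qed

lemma prob_up_interval:
  assumes "0 \<le> a" "a \<le> 1"
  shows "U.prob {u. 0 \<le> u \<and> u \<le> 1 \<and> a \<le> u} = 1 - a"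
proof -
  have "{u. 0 \<le> u \<and> u \<le> 1 \<and> a \<le> u} = {a..1}" using assms by auto
  then show ?thesis using assms by (simp add: measure_unit_lborel)
qed

text \<open>Both sides are the area between the graphs of \<open>F\<close> and \<open>G\<close>, cut
  into horizontal or vertical slices; \<open>?h\<close> is the indicator of that region.\<close>

lemma cdf_dist_flip: "cdf_dist (flip \<mu>) (flip \<nu>) = cdf_dist \<mu> \<nu>"
proof -
  interpret P: pair_prob_space unit_lborel unit_lborel ..
  let ?F = "line_cdf \<mu>" and ?G = "line_cdf \<nu>"
  let ?h = "\<lambda>t u. \<bar>(if ?F t \<le> u then 1 else 0) - (if ?G t \<le> u then 1 else 0 :: real)\<bar>"
  note [measurable] = measurable_unit_lborel[OF line_cdf_measurable]
    measurable_unit_lborel[OF measurable_ident_sets[OF refl]]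
  have [measurable]: "(\<lambda>x. x) \<in> borel_measurable unit_lborel"
    by (rule measurable_unit_lborel) simp
  have meas: "(\<lambda>(t, u). ?h t u) \<in> borel_measurable (unit_lborel \<Otimes>\<^sub>M unit_lborel)"
    by measurable
  have int: "integrable (unit_lborel \<Otimes>\<^sub>M unit_lborel) (\<lambda>(t, u). ?h t u)"
    by (rule P.P.integrable_const_bound[where B = 1]) (auto intro!: AE_I2 meas)
  have 1: "(\<integral>t. ?h t u \<partial>unit_lborel) = \<bar>line_cdf (flip \<mu>) u - line_cdf (flip \<nu>) u\<bar>" for u
  proof -
    let ?A = "{t\<in>space unit_lborel. ?F t \<le> u}" and ?B = "{t\<in>space unit_lborel. ?G t \<le> u}"
    have "(\<integral>t. ?h t u \<partial>unit_lborel) = (\<integral>t. \<bar>indicator ?A t - indicator ?B t\<bar> \<partial>unit_lborel)"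
      by (rule Bochner_Integration.integral_cong) (auto simp: indicator_def)
    also have "\<dots> = \<bar>U.prob ?A - U.prob ?B\<bar>"
      by (rule U.integral_abs_diff_indicator_nested[OF _ _ sublevel_nested])
        (auto intro: monoI line_cdf_mono intro!: sets_unit_lborelI simp: space_unit_lborel)
    finally show ?thesis by (simp only: line_cdf_flip_eq_measure_space)
  qed
  have 2: "(\<integral>u. ?h t u \<partial>unit_lborel) = \<bar>?F t - ?G t\<bar>" for t
  proof -
    let ?A = "{u\<in>space unit_lborel. ?F t \<le> u}" and ?B = "{u\<in>space unit_lborel. ?G t \<le> u}"
    have "(\<integral>u. ?h t u \<partial>unit_lborel) = (\<integral>u. \<bar>indicator ?A u - indicator ?B u\<bar> \<partial>unit_lborel)"
      by (rule Bochner_Integration.integral_cong) (auto simp: indicator_def)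
    also have "\<dots> = \<bar>U.prob ?A - U.prob ?B\<bar>"
      by (rule U.integral_abs_diff_indicator_nested)
        (use linear[of "?F t" "?G t"] in
          \<open>auto intro!: sets_unit_lborelI simp: space_unit_lborel\<close>)
    also have "\<dots> = \<bar>?F t - ?G t\<bar>" by (simp add: prob_up_interval space_unit_lborel)
    finally show ?thesis .
  qed
  show ?thesis
    using P.Fubini_integral[OF int] by (simp only: 1 2 cdf_dist_def)
qed

section \<open>Couplings and their transport cost\<close>

lemma coupling_marginals:
  assumes "\<pi> \<in> couplings \<mu> \<nu>"
  shows "prob_space \<pi>" "sets \<pi> = sets (unit_borel \<Otimes>\<^sub>M unit_borel)" "space \<pi> = {0..1} \<times> {0..1}"
    "fst \<in> measurable \<pi> unit_borel" "snd \<in> measurable \<pi> unit_borel"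
    "distr \<pi> unit_borel fst = measure_of_W1 \<mu>" "distr \<pi> unit_borel snd = measure_of_W1 \<nu>"
proof -
  show "prob_space \<pi>" and s: "sets \<pi> = sets (unit_borel \<Otimes>\<^sub>M unit_borel)"
    and "distr \<pi> unit_borel fst = measure_of_W1 \<mu>" "distr \<pi> unit_borel snd = measure_of_W1 \<nu>"
    using assms by (auto simp: couplings_def space_prob_algebra)
  show "space \<pi> = {0..1} \<times> {0..1}"
    using sets_eq_imp_space_eq[OF s] by (simp add: space_pair_measure space_restrict_space)
  show "fst \<in> measurable \<pi> unit_borel" "snd \<in> measurable \<pi> unit_borel"
    by (simp_all add: measurable_cong_sets[OF s refl])
qed

text \<open>On [0,1], |x - y| is the integral over \<open>t\<close> of the difference, in absolute
  value, of the indicators of \<open>x \<le> t\<close> and \<open>y \<le> t\<close>. Swapping the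
  integrals leaves quantities bounded below through the marginals.\<close>

lemma cdf_dist_le_cost:
  assumes c: "\<pi> \<in> couplings \<mu> \<nu>"
  shows "cdf_dist \<mu> \<nu> \<le> (\<integral>(x, y). \<bar>x - y\<bar> \<partial>\<pi>)"
proof -
  note cm = coupling_marginals[OF c]
  interpret Pi: prob_space \<pi> by (rule cm)
  interpret P: pair_prob_space \<pi> unit_lborel ..
  let ?h = "\<lambda>p t. \<bar>(if fst p \<le> t then 1 else 0) - (if snd p \<le> t then 1 else 0 :: real)\<bar>"
  have id: "(\<lambda>x. x) \<in> borel_measurable unit_borel"
    by (rule measurable_restrict_space1) simp
  have [measurable]: "fst \<in> borel_measurable \<pi>" "snd \<in> borel_measurable \<pi>"
    using measurable_compose[OF cm(4) id] measurable_compose[OF cm(5) id] by simp_all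
  have [measurable]: "(\<lambda>x. x) \<in> borel_measurable unit_lborel"
    by (rule measurable_unit_lborel) simp
  have meas: "(\<lambda>(p, t). ?h p t) \<in> borel_measurable (\<pi> \<Otimes>\<^sub>M unit_lborel)"
    by measurable
  have int: "integrable (\<pi> \<Otimes>\<^sub>M unit_lborel) (\<lambda>(p, t). ?h p t)"
    by (rule P.P.integrable_const_bound[where B = 1]) (auto intro!: AE_I2 meas)
  have 1: "(\<integral>t. ?h p t \<partial>unit_lborel) = \<bar>fst p - snd p\<bar>" if p: "p \<in> space \<pi>" for p
  proof -
    let ?A = "{t\<in>space unit_lborel. fst p \<le> t}" and ?B = "{t\<in>space unit_lborel. snd p \<le> t}"
    have "(\<integral>t. ?h p t \<partial>unit_lborel) = (\<integral>t. \<bar>indicator ?A t - indicator ?B t\<bar> \<partial>unit_lborel)"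
      by (rule Bochner_Integration.integral_cong) (auto simp: indicator_def)
    also have "\<dots> = \<bar>U.prob ?A - U.prob ?B\<bar>"
      by (rule U.integral_abs_diff_indicator_nested)
        (use linear[of "fst p" "snd p"] in
          \<open>auto intro!: sets_unit_lborelI simp: space_unit_lborel\<close>)
    also have "\<dots> = \<bar>fst p - snd p\<bar>" 
      using p by (auto simp: cm(3) prob_up_interval space_unit_lborel)
    finally show ?thesis .
  qed
  have marg: "(\<integral>p. (if f p \<le> t then 1 else 0 :: real) \<partial>\<pi>) = line_cdf \<rho> t"
    if f: "f \<in> measurable \<pi> unit_borel" and d: "distr \<pi> unit_borel f = measure_of_W1 \<rho>" for f \<rho> t
  proof -
    have "(\<integral>p. (if f p \<le> t then 1 else 0 :: real) \<partial>\<pi>)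
        = (\<integral>p. indicator (f -` ({..t} \<inter> {0..1}) \<inter> space \<pi>) p \<partial>\<pi>)"
      using measurable_space[OF f]
      by (intro Bochner_Integration.integral_cong) (auto simp: indicator_def space_restrict_space)
    also have "\<dots> = measure \<pi> (f -` ({..t} \<inter> {0..1}) \<inter> space \<pi>)"
      by (simp add: Int_absorb2)
    also have "\<dots> = line_cdf \<rho> t"
      unfolding line_cdf_eq_measure d[symmetric]
      by (rule measure_distr[OF f atMost_unit_borel, symmetric])
    finally show ?thesis .
  qed
  \<comment> \<open>For a general coupling the events \<open>fst p \<le> t\<close> and
    \<open>snd p \<le> t\<close> need not be nested, so only an inequality results.\<close>
  have 2: "\<bar>line_cdf \<mu> t - line_cdf \<nu> t\<bar> \<le> (\<integral>p. ?h p t \<partial>\<pi>)" for t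
  proof -
    let ?a = "\<lambda>p. if fst p \<le> t then 1 else 0 :: real" and ?b = "\<lambda>p. if snd p \<le> t then 1 else 0 :: real"
    have "integrable \<pi> ?a" "integrable \<pi> ?b"
      by (rule Pi.integrable_const_bound[where B = 1]; simp)+
    then have "line_cdf \<mu> t - line_cdf \<nu> t = (\<integral>p. ?a p - ?b p \<partial>\<pi>)"
      using marg[OF cm(4,6), of t] marg[OF cm(5,7), of t] by simp
    then show ?thesis using integral_abs_bound[of \<pi> "\<lambda>p. ?a p - ?b p"] by simp
  qed
  have "cdf_dist \<mu> \<nu> \<le> (\<integral>t. (\<integral>p. ?h p t \<partial>\<pi>) \<partial>unit_lborel)"
    unfolding cdf_dist_def
  proof (rule integral_mono)
    show "integrable unit_lborel (\<lambda>x. \<bar>line_cdf \<mu> x - line_cdf \<nu> x\<bar>)"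
      by (rule integrable_unit_lborel[where B = 1]) auto
    show "integrable unit_lborel (\<lambda>t. (\<integral>p. ?h p t \<partial>\<pi>))"
      using P.integrable_snd[OF int] .
  qed (rule 2)
  also have "\<dots> = (\<integral>p. (\<integral>t. ?h p t \<partial>unit_lborel) \<partial>\<pi>)"
    by (rule P.Fubini_integral[OF int])
  also have "\<dots> = (\<integral>p. \<bar>fst p - snd p\<bar> \<partial>\<pi>)"
    by (rule Bochner_Integration.integral_cong[OF refl 1])
  finally show ?thesis unfolding case_prod_beta .
qed

text \<open>The monotone coupling: both measures are realised by their quantile functions at the
  same uniform \<open>u\<close>. By \<open>flip_flip\<close> the marginals are right, and the cost
  is the distance of the flipped measures, which equals that of the originals.\<close>

lemma quantile_coupling:
  fixes \<mu> \<nu>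
  defines "\<pi> \<equiv> distr unit_lborel (unit_borel \<Otimes>\<^sub>M unit_borel)
    (\<lambda>u. (line_cdf (flip \<mu>) u, line_cdf (flip \<nu>) u))"
  shows "\<pi> \<in> couplings \<mu> \<nu>" "(\<integral>(x, y). \<bar>x - y\<bar> \<partial>\<pi>) = cdf_dist \<mu> \<nu>"
proof -
  let ?q = "\<lambda>u. (line_cdf (flip \<mu>) u, line_cdf (flip \<nu>) u)"
  note [measurable] = line_cdf_measurable_unit
  have q[measurable]: "?q \<in> measurable unit_lborel (unit_borel \<Otimes>\<^sub>M unit_borel)"
    by measurable
  have "distr \<pi> unit_borel fst = measure_of_W1 \<mu>"
    using measure_of_flip[of "flip \<mu>"]
    by (simp add: \<pi>_def distr_distr[OF measurable_fst q] comp_def flip_flip)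
  moreover have "distr \<pi> unit_borel snd = measure_of_W1 \<nu>"
    using measure_of_flip[of "flip \<nu>"]
    by (simp add: \<pi>_def distr_distr[OF measurable_snd q] comp_def flip_flip)
  ultimately show "\<pi> \<in> couplings \<mu> \<nu>"
    by (auto simp: couplings_def space_prob_algebra \<pi>_def intro!: U.prob_space_distr q)
  have [measurable]: "(\<lambda>x. x) \<in> measurable unit_borel borel"
    by (rule measurable_restrict_space1) simp
  have m: "(\<lambda>(x, y). \<bar>x - y\<bar>) \<in> borel_measurable (unit_borel \<Otimes>\<^sub>M unit_borel)"
    unfolding case_prod_beta
    by (intro borel_measurable_abs borel_measurable_diff
        measurable_compose[OF measurable_fst] measurable_compose[OF measurable_snd]) measurable
  have "(\<integral>(x, y). \<bar>x - y\<bar> \<partial>\<pi>) = cdf_dist (flip \<mu>) (flip \<nu>)"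
    unfolding \<pi>_def integral_distr[OF q m] by (simp add: cdf_dist_def)
  then show "(\<integral>(x, y). \<bar>x - y\<bar> \<partial>\<pi>) = cdf_dist \<mu> \<nu>"
    by (simp add: cdf_dist_flip)
qed

lemma W1_dist_eq_cdf_dist: "W1_dist = cdf_dist"
proof (intro ext antisym)
  fix \<mu> \<nu>
  have "bdd_below ((\<lambda>\<pi>. \<integral>(x, y). \<bar>x - y\<bar> \<partial>\<pi>) ` couplings \<mu> \<nu>)"
    by (rule bdd_belowI2[OF cdf_dist_le_cost])
  then show "W1_dist \<mu> \<nu> \<le> cdf_dist \<mu> \<nu>"
    unfolding W1_dist_def quantile_coupling(2)[symmetric]
    by (rule cINF_lower) (rule quantile_coupling)
  show "cdf_dist \<mu> \<nu> \<le> W1_dist \<mu> \<nu>"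
    unfolding W1_dist_def by (rule cINF_greatest[OF couplings_nonempty cdf_dist_le_cost])
qed

section \<open>Reflection and Dirac masses\<close>

lemma reflect_measurable: "(\<lambda>x::real. 1 - x) \<in> measurable unit_borel unit_borel"
  by (rule measurable_restrict_space3) auto

lemma distr_reflect_unit_lborel: "distr unit_lborel unit_lborel (\<lambda>x. 1 - x) = unit_lborel"
proof (rule measure_eqI)
  have m: "(\<lambda>x::real. 1 - x) \<in> measurable unit_lborel unit_lborel"
    by (rule measurable_restrict_space3) auto
  fix A assume "A \<in> sets (distr unit_lborel unit_lborel (\<lambda>x. 1 - x))"
  then have A: "A \<in> sets unit_lborel" by simp
  then have [measurable]: "A \<in> sets borel" and sub: "A \<subseteq> {0..1}"
    by (auto simp: sets_restrict_space_iff)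
  have lb: "lborel = distr lborel borel (\<lambda>x::real. 1 - x)"
    using lborel_real_affine[of "-1" 1] by (simp add: density_1)
  have "emeasure (distr unit_lborel unit_lborel (\<lambda>x. 1 - x)) A
      = emeasure unit_lborel ((\<lambda>x. 1 - x) -` A \<inter> {0..1})"
    by (simp add: emeasure_distr[OF m A] space_unit_lborel)
  also have "(\<lambda>x. 1 - x) -` A \<inter> {0..1} = (\<lambda>x. 1 - x) -` A"
    using sub by auto
  also have "emeasure unit_lborel ((\<lambda>x. 1 - x) -` A) = emeasure lborel ((\<lambda>x. 1 - x) -` A)"
    using sub by (intro emeasure_restrict_space) auto
  also have "\<dots> = emeasure (distr lborel borel (\<lambda>x. 1 - x)) A"
    by (subst emeasure_distr) auto
  also have "\<dots> = emeasure lborel A" by (simp add: lb[symmetric])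
  also have "\<dots> = emeasure unit_lborel A"
    using sub by (intro emeasure_restrict_space[symmetric]) auto
  finally show "emeasure (distr unit_lborel unit_lborel (\<lambda>x. 1 - x)) A = emeasure unit_lborel A" .
qed simp

text \<open>The left side is the mass of [1-x, 1] and the right side that of (1-x, 1]. They differ
  only if 1-x is an atom, and there are countably many atoms.\<close>

lemma line_cdf_reflection_AE:
  "AE x in unit_lborel. line_cdf (reflection \<mu>) x = 1 - line_cdf \<mu> (1 - x)"
proof -
  let ?M = "measure_of_W1 \<mu>"
  interpret M: prob_space ?M by (rule W1_prob)
  have setM: "A \<in> sets ?M" if "A \<in> sets borel" "A \<subseteq> {0..1}" for A
    using that by (simp add: W1_prob sets_restrict_space_iff)
  have eq: "line_cdf (reflection \<mu>) x = 1 - line_cdf \<mu> (1 - x)"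
    if x: "x \<in> {0..1}" and "measure ?M {1 - x} = 0" for x
  proof -
    have r: "(\<lambda>x. 1 - x) \<in> measurable ?M unit_borel"
      unfolding measurable_W1 by (rule reflect_measurable)
    have "line_cdf (reflection \<mu>) x = measure ?M {1 - x..1}"
    proof -
      have "(\<lambda>x. 1 - x) -` ({..x} \<inter> {0..1}) \<inter> space ?M = {1 - x..1}"
        using x by (auto simp: W1_prob)
      then show ?thesis
        unfolding line_cdf_eq_measure measure_of_reflection
        by (simp only: measure_distr[OF r atMost_unit_borel])
    qed
    also have "{1 - x..1} = {1 - x} \<union> {1 - x<..1}" using x by auto
    also have "measure ?M \<dots> = measure ?M {1 - x} + measure ?M {1 - x<..1}"
      by (rule M.finite_measure_Union) (use x in \<open>auto intro!: setM\<close>)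
    also have "\<dots> = measure ?M {1 - x<..1}" using that by simp
    also have "\<dots> = measure ?M (space ?M - ({..1 - x} \<inter> {0..1}))"
      by (rule arg_cong[where f = "measure ?M"]) (use x in \<open>auto simp: W1_prob\<close>)
    also have "\<dots> = 1 - line_cdf \<mu> (1 - x)"
      unfolding line_cdf_eq_measure by (rule M.prob_compl) (auto intro!: setM)
    finally show ?thesis .
  qed
  let ?N = "(\<lambda>y. 1 - y) ` {y. measure ?M {y} \<noteq> 0}"
  have "countable ?N" by (intro countable_image M.countable_support)
  then have "?N \<in> null_sets lborel" by (rule countable_imp_null_set_lborel)
  then have "AE x in lborel. x \<notin> ?N" by (rule AE_not_in)
  then have "AE x in lborel. x \<in> {0..1} \<longrightarrow> line_cdf (reflection \<mu>) x = 1 - line_cdf \<mu> (1 - x)"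
  proof eventually_elim
    case (elim x)
    have "measure ?M {1 - x} = 0"
    proof (rule ccontr)
      assume "measure ?M {1 - x} \<noteq> 0"
      then have "1 - (1 - x) \<in> ?N" by blast
      with elim show False by simp
    qed
    with eq show ?case by blast
  qed
  moreover have "{0..1::real} \<inter> space lborel \<in> sets lborel" by simp
  ultimately show ?thesis by (simp only: AE_restrict_space_iff)
qed

lemma cdf_dist_reflection: "cdf_dist (reflection \<mu>) (reflection \<nu>) = cdf_dist \<mu> \<nu>"
proof -
  let ?d = "\<lambda>x. \<bar>line_cdf \<mu> x - line_cdf \<nu> x\<bar>"
  have [measurable]: "(\<lambda>x::real. 1 - x) \<in> measurable unit_lborel unit_lborel"
    by (rule measurable_restrict_space3) auto
  note [measurable] = measurable_unit_lborel[OF line_cdf_measurable]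
  have "AE x in unit_lborel. \<bar>line_cdf (reflection \<mu>) x - line_cdf (reflection \<nu>) x\<bar> = ?d (1 - x)"
    using line_cdf_reflection_AE[of \<mu>] line_cdf_reflection_AE[of \<nu>]
    by eventually_elim (simp add: abs_minus_commute)
  then have "cdf_dist (reflection \<mu>) (reflection \<nu>) = (\<integral>x. ?d (1 - x) \<partial>unit_lborel)"
    unfolding cdf_dist_def
    by (intro integral_cong_AE) (auto intro!: measurable_unit_lborel)
  also have "\<dots> = (\<integral>x. ?d x \<partial>distr unit_lborel unit_lborel (\<lambda>x. 1 - x))"
    by (rule integral_distr[symmetric]) measurable
  finally show ?thesis by (simp add: distr_reflect_unit_lborel cdf_dist_def)
qed

lemma reflection_reflection: "reflection (reflection \<mu>) = \<mu>"
proof -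
  have "(\<lambda>x. 1 - x) \<in> measurable (measure_of_W1 \<mu>) unit_borel"
    unfolding measurable_W1 by (rule reflect_measurable)
  then have "measure_of_W1 (reflection (reflection \<mu>)) = distr (measure_of_W1 \<mu>) unit_borel (\<lambda>x. x)"
    by (simp add: measure_of_reflection distr_distr[OF reflect_measurable] comp_def)
  also have "\<dots> = measure_of_W1 \<mu>" by (rule distr_id2) (simp add: W1_prob)
  finally show ?thesis by (simp add: measure_of_W1_inject)
qed

lemma reflection_push_unit:
  assumes f: "f \<in> measurable unit_lborel unit_borel"
  shows "reflection (push_unit f) = push_unit (\<lambda>u. 1 - f u)"
proof -
  have "(\<lambda>u. 1 - f u) \<in> measurable unit_lborel unit_borel"
    by (rule measurable_compose[OF f reflect_measurable])
  then have "measure_of_W1 (reflection (push_unit f)) = measure_of_W1 (push_unit (\<lambda>u. 1 - f u))"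
    by (simp add: measure_of_reflection measure_of_push_unit f distr_distr[OF reflect_measurable f] comp_def)
  then show ?thesis by (simp add: measure_of_W1_inject)
qed

text \<open>Both are the law of \<open>1 - F u\<close> for uniform \<open>u\<close>: on the right
  \<open>u\<close> is replaced by \<open>1 - u\<close>, which has the same law, and null sets do not
  affect laws.\<close>

lemma reflection_flip: "reflection (flip \<mu>) = flip (reflection \<mu>)"
proof -
  let ?g = "\<lambda>u. 1 - line_cdf \<mu> u"
  have r: "(\<lambda>x::real. 1 - x) \<in> measurable unit_lborel unit_lborel"
    by (rule measurable_restrict_space3) auto
  have g: "?g \<in> measurable unit_lborel unit_borel"
    by (rule measurable_compose[OF line_cdf_measurable_unit reflect_measurable])
  have "measure_of_W1 (flip (reflection \<mu>)) = distr unit_lborel unit_borel (\<lambda>u. ?g (1 - u))"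
    unfolding measure_of_flip
    by (rule distr_cong_AE[OF refl refl line_cdf_reflection_AE line_cdf_measurable_unit])
      (rule measurable_compose[OF r g])
  also have "\<dots> = distr (distr unit_lborel unit_lborel (\<lambda>x. 1 - x)) unit_borel ?g"
    by (simp add: distr_distr[OF g r] comp_def)
  also have "\<dots> = measure_of_W1 (reflection (flip \<mu>))"
    by (simp add: distr_reflect_unit_lborel flip_eq_push_unit measure_of_push_unit[OF g]
        reflection_push_unit line_cdf_measurable_unit)
  finally show ?thesis by (simp add: measure_of_W1_inject)
qed

definition dirac :: "real \<Rightarrow> W1" where
  "dirac t = push_unit (\<lambda>_. t)"

lemma const_measurable_unit: "t \<in> {0..1} \<Longrightarrow> (\<lambda>_. t) \<in> measurable unit_lborel unit_borel"
  by (auto simp: space_restrict_space)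

lemma line_cdf_dirac:
  assumes "t \<in> {0..1}"
  shows "line_cdf (dirac t) x = (if t \<le> x then 1 else 0)"
proof -
  have eq: "{s\<in>{0..1}. t \<le> x} = (if t \<le> x then {0..1} else {})" for x by auto
  show ?thesis
    unfolding dirac_def line_cdf_push_unit[OF const_measurable_unit[OF assms]] eq
    by (cases "t \<le> x") (simp_all only: if_True if_False prob_unit_interval measure_empty)
qed

lemma reflection_dirac: "t \<in> {0..1} \<Longrightarrow> reflection (dirac t) = dirac (1 - t)"
  by (simp add: dirac_def reflection_push_unit const_measurable_unit)

text \<open>Thus \<open>flip (dirac c)\<close> is the two-point measure with mass \<open>c\<close>
  at 0 and \<open>1 - c\<close> at 1.\<close>

lemma line_cdf_flip_dirac:
  assumes "c \<in> {0..1}" "0 \<le> x" "x < 1"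
  shows "line_cdf (flip (dirac c)) x = c"
proof -
  have "{t\<in>{0..1}. line_cdf (dirac c) t \<le> x} = {0..<c}"
    using assms by (auto simp: line_cdf_dirac split: if_splits)
  then show ?thesis
    using assms by (simp add: line_cdf_flip_eq_measure measure_unit_lborel)
qed

lemma flip_dirac_0: "flip (dirac 0) = dirac 1"
  by (rule W1_eqI_line_cdf) (simp add: line_cdf_flip_dirac line_cdf_dirac)

lemma flip_dirac_1: "flip (dirac 1) = dirac 0"
  by (rule W1_eqI_line_cdf) (simp add: line_cdf_flip_dirac line_cdf_dirac)

section \<open>Means and Chebyshev's inequality\<close>

lemma integrable_line_cdf:
  "integrable unit_lborel (line_cdf \<mu>)"
  "integrable unit_lborel (\<lambda>x. line_cdf \<mu> x * line_cdf \<nu> x)"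
  "integrable unit_lborel (\<lambda>x. min (line_cdf \<mu> x) (line_cdf \<nu> x))"
  by (rule integrable_unit_lborel[where B = 1];
      auto simp: abs_mult min_def intro: mult_le_one)+

text \<open>This is one minus the expectation of the measure, and also its distance to
  \<open>dirac 1\<close>.\<close>

definition cdf_mean :: "W1 \<Rightarrow> real" where
  "cdf_mean \<mu> = (\<integral>x. line_cdf \<mu> x \<partial>unit_lborel)"

lemma cdf_dist_eq_min:
  "cdf_dist \<mu> \<nu> = cdf_mean \<mu> + cdf_mean \<nu> - 2 * (\<integral>x. min (line_cdf \<mu> x) (line_cdf \<nu> x) \<partial>unit_lborel)"
proof -
  have "\<bar>line_cdf \<mu> x - line_cdf \<nu> x\<bar>
      = line_cdf \<mu> x + line_cdf \<nu> x - 2 * min (line_cdf \<mu> x) (line_cdf \<nu> x)" for x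
    by (simp add: min_def)
  then show ?thesis
    by (simp add: cdf_dist_def cdf_mean_def integrable_line_cdf)
qed

lemma integral_unit_lborel_cong_interior:
  fixes f g :: "real \<Rightarrow> real"
  assumes "\<And>x. 0 < x \<Longrightarrow> x < 1 \<Longrightarrow> f x = g x"
    and "f \<in> borel_measurable borel" "g \<in> borel_measurable borel"
  shows "(\<integral>x. f x \<partial>unit_lborel) = (\<integral>x. g x \<partial>unit_lborel)"
  by (intro integral_cong_AE measurable_unit_lborel AE_unit_lborel_interior assms)

lemma cdf_mean_const:
  assumes "\<And>x. 0 < x \<Longrightarrow> x < 1 \<Longrightarrow> line_cdf \<mu> x = c"
  shows "cdf_mean \<mu> = c"
proof -
  have "cdf_mean \<mu> = (\<integral>x. c \<partial>unit_lborel)"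
    unfolding cdf_mean_def by (rule integral_unit_lborel_cong_interior) (auto simp: assms)
  then show ?thesis by simp
qed

lemma cdf_mean_dirac:
  assumes "t \<in> {0..1}"
  shows "cdf_mean (dirac t) = 1 - t"
proof -
  have "cdf_mean (dirac t) = (\<integral>x. indicator {t..1} x \<partial>unit_lborel)"
    unfolding cdf_mean_def
    by (rule Bochner_Integration.integral_cong)
      (auto simp: space_unit_lborel line_cdf_dirac[OF assms] indicator_def)
  also have "\<dots> = measure unit_lborel ({t..1} \<inter> space unit_lborel)" by simp
  also have "{t..1} \<inter> space unit_lborel = {t..1}" using assms by (auto simp: space_unit_lborel)
  finally show ?thesis using assms by (simp add: measure_unit_lborel)
qed

lemma cdf_mean_flip_dirac: "c \<in> {0..1} \<Longrightarrow> cdf_mean (flip (dirac c)) = c"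
  by (rule cdf_mean_const) (simp add: line_cdf_flip_dirac)

lemma cdf_mean_bounds: "0 \<le> cdf_mean \<mu>" "cdf_mean \<mu> \<le> 1"
proof -
  show "0 \<le> cdf_mean \<mu>" unfolding cdf_mean_def by (rule Bochner_Integration.integral_nonneg) simp
  have "cdf_mean \<mu> \<le> (\<integral>x. 1 \<partial>unit_lborel)"
    unfolding cdf_mean_def by (rule integral_mono) (auto simp: integrable_line_cdf)
  then show "cdf_mean \<mu> \<le> 1" by simp
qed

lemma cdf_dist_dirac_1: "cdf_dist \<mu> (dirac 1) = cdf_mean \<mu>"
proof -
  have "(\<integral>x. min (line_cdf \<mu> x) (line_cdf (dirac 1) x) \<partial>unit_lborel) = (\<integral>x. 0 \<partial>unit_lborel)"
    by (rule integral_unit_lborel_cong_interior) (auto simp: line_cdf_dirac min_def intro: antisym)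
  then show ?thesis by (simp add: cdf_dist_eq_min cdf_mean_dirac)
qed

text \<open>If \<open>\<bar>F - G\<bar> = 1\<close> almost everywhere, then \<open>F + G = 1\<close>, so \<open>F = 1 - G\<close> is both increasing
  and decreasing.\<close>

lemma cdf_dist_eq_1:
  assumes "cdf_dist \<mu> \<nu> = 1"
  shows "\<mu> = dirac 0 \<and> \<nu> = dirac 1 \<or> \<mu> = dirac 1 \<and> \<nu> = dirac 0"
proof -
  let ?F = "line_cdf \<mu>" and ?G = "line_cdf \<nu>"
  let ?d = "\<lambda>x. 1 - \<bar>?F x - ?G x\<bar>"
  have int: "integrable unit_lborel (\<lambda>x. \<bar>?F x - ?G x\<bar>)"
    by (rule integrable_unit_lborel[where B = 1]) auto
  have "(\<integral>x. ?d x \<partial>unit_lborel) = 1 - cdf_dist \<mu> \<nu>"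
    using int U.prob_space by (simp add: cdf_dist_def)
  then have "(\<integral>x. ?d x \<partial>unit_lborel) = 0" using assms by simp
  then have ae: "AE x in unit_lborel. ?d x = 0"
    using int by (subst (asm) integral_nonneg_eq_0_iff_AE) auto
  have d0: "?d x = 0" if "0 \<le> x" "x < 1" for x
    by (rule right_cont_eq_of_AE[OF ae _ _ that]) (intro tendsto_intros line_cdf_right_cont)+
  have vals: "?F x = 0 \<and> ?G x = 1 \<or> ?F x = 1 \<and> ?G x = 0" if "0 \<le> x" "x < 1" for x
    using d0[OF that] line_cdf_nonneg[of \<mu> x] line_cdf_nonneg[of \<nu> x]
      line_cdf_le_1[of \<mu> x] line_cdf_le_1[of \<nu> x] by (smt (verit))
  have const: "?F x = ?F 0" "?G x = ?G 0" if "0 \<le> x" "x < 1" for x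
    using vals[OF that] vals[of 0] line_cdf_mono[OF that(1), of \<mu>] line_cdf_mono[OF that(1), of \<nu>]
    by auto
  from vals[of 0] consider "?F 0 = 0" "?G 0 = 1" | "?F 0 = 1" "?G 0 = 0" by auto
  then show ?thesis
  proof cases
    case 1
    have "\<mu> = dirac 1" "\<nu> = dirac 0"
      by (rule W1_eqI_line_cdf; subst const; simp add: 1 line_cdf_dirac)+
    then show ?thesis by simp
  next
    case 2
    have "\<mu> = dirac 0" "\<nu> = dirac 1"
      by (rule W1_eqI_line_cdf; subst const; simp add: 2 line_cdf_dirac)+
    then show ?thesis by simp
  qed
qed

text \<open>If \<open>F\<close> crosses its mean \<open>p\<close> at \<open>a\<close>,
  then \<open>(F - p) (G - G a)\<close> is nonnegative.\<close>

lemma cdf_chebyshev: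
  fixes \<mu> \<nu> :: W1
  defines "I \<equiv> (\<integral>x. line_cdf \<mu> x * line_cdf \<nu> x \<partial>unit_lborel)"
  shows "cdf_mean \<mu> * cdf_mean \<nu> \<le> I"
    and "I = cdf_mean \<mu> * cdf_mean \<nu> \<Longrightarrow>
      (\<exists>c. \<forall>x. 0 \<le> x \<and> x < 1 \<longrightarrow> line_cdf \<mu> x = c) \<or> (\<exists>c. \<forall>x. 0 \<le> x \<and> x < 1 \<longrightarrow> line_cdf \<nu> x = c)"
proof -
  let ?F = "line_cdf \<mu>" and ?G = "line_cdf \<nu>" and ?p = "cdf_mean \<mu>"
  \<comment> \<open>The infimum of \<open>S\<close> is where \<open>F\<close> crosses its mean;
    \<open>S\<close> contains 1 because \<open>F 1 = 1\<close>.\<close>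
  define S where "S = {x. 0 \<le> x \<and> ?p \<le> ?F x}"
  define a where "a = Inf S"
  have 1: "1 \<in> S" using cdf_mean_bounds by (simp add: S_def)
  have bdd: "bdd_below S" by (auto simp: S_def intro: bdd_belowI[of _ 0])
  have ne: "S \<noteq> {}" using 1 by blast
  have "0 \<le> a" unfolding a_def by (rule cInf_greatest[OF ne]) (simp add: S_def)
  have below: "?F x < ?p" if "0 \<le> x" "x < a" for x
    using cInf_lower[OF _ bdd, of x] that by (force simp: a_def S_def)
  have above_strict: "?p \<le> ?F x" if ax: "a < x" for x
  proof -
    obtain y where "y \<in> S" "y < x"
      using ax cInf_less_iff[OF ne bdd] by (auto simp: a_def)
    then show ?thesis using line_cdf_mono[of y x \<mu>] by (auto simp: S_def)
  qed
  have above: "?p \<le> ?F x" if "a \<le> x" for x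
  proof (cases "a = x")
    case True
    show ?thesis
      by (rule tendsto_lowerbound[OF line_cdf_right_cont])
        (auto simp: eventually_at_right_field True intro!: exI[of _ "x + 1"] above_strict)
  qed (use that above_strict in auto)
  \<comment> \<open>Since \<open>F - p\<close> integrates to 0, subtracting the constant
    \<open>G a\<close> does not change the integral, which is therefore the Chebyshev
    defect.\<close>
  define w where "w x = (?F x - ?p) * (?G x - ?G a)" for x
  have w_nonneg: "0 \<le> w x" if "0 \<le> x" for x
    using below[of x] above[of x] that line_cdf_mono[of x a \<nu>] line_cdf_mono[of a x \<nu>]
    unfolding w_def by (cases "x < a") (auto intro!: mult_nonneg_nonneg mult_nonpos_nonpos)
  have w_eq: "w x = ?F x * ?G x - ?G a * ?F x - ?p * ?G x + ?p * ?G a" for x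
    by (simp add: w_def algebra_simps)
  have int_w: "integrable unit_lborel w"
    unfolding w_eq by (intro Bochner_Integration.integrable_add Bochner_Integration.integrable_diff
        integrable_line_cdf integrable_mult_right) auto
  have w_int: "(\<integral>x. w x \<partial>unit_lborel) = I - ?p * cdf_mean \<nu>"
    unfolding w_eq I_def using U.prob_space
    by (simp add: integrable_line_cdf cdf_mean_def[symmetric])
  have w_AE: "AE x in unit_lborel. 0 \<le> w x"
    by (rule AE_unit_lborel_interior) (simp add: w_nonneg)
  from integral_nonneg_AE[OF w_AE] show "?p * cdf_mean \<nu> \<le> I" by (simp add: w_int)
  assume "I = ?p * cdf_mean \<nu>"
  then have ae: "AE x in unit_lborel. w x = 0"
    using integral_nonneg_eq_0_iff_AE[OF int_w w_AE] w_int by simp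
  have w0: "w x = 0" if "0 \<le> x" "x < 1" for x
    by (rule right_cont_eq_of_AE[OF ae _ _ that])
      (unfold w_def, (intro tendsto_intros line_cdf_right_cont)+)
  show "(\<exists>c. \<forall>x. 0 \<le> x \<and> x < 1 \<longrightarrow> ?F x = c) \<or> (\<exists>c. \<forall>x. 0 \<le> x \<and> x < 1 \<longrightarrow> ?G x = c)"
  proof (rule disjCI)
    assume nG: "\<not> (\<exists>c. \<forall>x. 0 \<le> x \<and> x < 1 \<longrightarrow> ?G x = c)"
    have mean0: "(\<integral>x. ?F x - ?p \<partial>unit_lborel) = 0"
      using U.prob_space by (simp add: integrable_line_cdf cdf_mean_def)
    have intF: "integrable unit_lborel (\<lambda>x. ?F x - ?p)"
      by (intro Bochner_Integration.integrable_diff integrable_line_cdf) simp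
    obtain y where y: "0 \<le> y" "y < 1" "?G y \<noteq> ?G a" using nG by blast
    have "?F x = ?p" if x: "0 \<le> x" "x < 1" for x
    proof -
      \<comment> \<open>At \<open>y\<close> the second factor of \<open>w\<close> is nonzero, so
        \<open>F y = p\<close>. Left of \<open>a\<close> this contradicts \<open>below\<close>;
        otherwise \<open>F\<close> equals \<open>p\<close> from \<open>y\<close> on and is at most
        \<open>p\<close> before. A function of one sign with integral 0 vanishes almost
        everywhere.\<close>
      have sgn: "(\<forall>x. 0 < x \<and> x < 1 \<longrightarrow> 0 \<le> ?F x - ?p) \<or> (\<forall>x. 0 < x \<and> x < 1 \<longrightarrow> ?F x - ?p \<le> 0)"
      proof (cases "y < a")
        case True
        have Fy: "?F y = ?p" using w0[OF y(1,2)] y(3) by (simp add: w_def)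
        with below[OF y(1) True] show ?thesis by simp
      next
        case False
        then have Gy: "?G a < ?G y" "a \<le> y" using line_cdf_mono[of a y \<nu>] y(3) by auto
        have "?F z - ?p \<le> 0" if "z < 1" for z
        proof (cases "z < y")
          case True
          then show ?thesis using line_cdf_mono[of z y \<mu>] w0[OF y(1,2)] y(3) by (simp add: w_def)
        next
          case False
          then have "?G z \<noteq> ?G a" using line_cdf_mono[of y z \<nu>] Gy by auto
          then show ?thesis using w0[of z] that False y(1) by (simp add: w_def)
        qed
        then show ?thesis by blast
      qed
      have "AE x in unit_lborel. ?F x - ?p = 0"
        using sgn
      proof
        assume "\<forall>x. 0 < x \<and> x < 1 \<longrightarrow> 0 \<le> ?F x - ?p"
        then have "AE x in unit_lborel. 0 \<le> ?F x - ?p" by (intro AE_unit_lborel_interior) auto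
        from integral_nonneg_eq_0_iff_AE[OF intF this] mean0 show ?thesis by simp
      next
        assume "\<forall>x. 0 < x \<and> x < 1 \<longrightarrow> ?F x - ?p \<le> 0"
        then have "AE x in unit_lborel. 0 \<le> - (?F x - ?p)" by (intro AE_unit_lborel_interior) auto
        moreover have "(\<integral>x. - (?F x - ?p) \<partial>unit_lborel) = 0"
          unfolding Bochner_Integration.integral_minus mean0 by simp
        ultimately have "AE x in unit_lborel. - (?F x - ?p) = 0"
          using integral_nonneg_eq_0_iff_AE[OF integrable_minus[OF intF]] by blast
        then show ?thesis by eventually_elim simp
      qed
      then have "AE x in unit_lborel. ?F x = ?p" by eventually_elim simp
      then show ?thesis
        by (rule right_cont_eq_of_AE) (auto intro: line_cdf_right_cont x)
    qed
    then show "\<exists>c. \<forall>x. 0 \<le> x \<and> x < 1 \<longrightarrow> ?F x = c" by blast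
  qed
qed

section \<open>Extremal pairs\<close>

text \<open>\<open>flip\<close> turns a two-valued distribution function into a constant one.\<close>

lemma eq_dirac_of_two_valued:
  assumes two: "\<And>x. 0 \<le> x \<Longrightarrow> x < 1 \<Longrightarrow> line_cdf \<mu> x = 0 \<or> line_cdf \<mu> x = 1"
  shows "\<mu> = dirac (1 - cdf_mean \<mu>)"
proof -
  let ?S = "{t\<in>{0..1}. line_cdf \<mu> t \<le> 0}"
  let ?c = "U.prob ?S"
  have c: "?c \<in> {0..1}" using U.prob_le_1 by simp
  \<comment> \<open>As \<open>F\<close> takes no value strictly between 0 and 1, every sublevel set
    at a level below 1 is the zero set.\<close>
  have const: "line_cdf (flip \<mu>) u = ?c" if u: "0 \<le> u" "u < 1" for u
  proof -
    have "line_cdf \<mu> t \<le> u \<longleftrightarrow> line_cdf \<mu> t \<le> 0" if "t \<in> {0..1}" for t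
      using two[of t] that u by (cases "t = 1") auto
    then have "{t\<in>{0..1}. line_cdf \<mu> t \<le> u} = ?S" by blast
    then show ?thesis by (simp only: line_cdf_flip_eq_measure)
  qed
  have "flip \<mu> = flip (dirac ?c)"
    by (rule W1_eqI_line_cdf) (simp only: const line_cdf_flip_dirac[OF c])
  then have "\<mu> = dirac ?c" by (metis flip_flip)
  moreover from this have "cdf_mean \<mu> = 1 - ?c" using cdf_mean_dirac[OF c] by metis
  ultimately show ?thesis by simp
qed

lemma eq_flip_dirac_of_const:
  assumes const: "\<And>x. 0 \<le> x \<Longrightarrow> x < 1 \<Longrightarrow> line_cdf \<mu> x = c"
  shows "\<mu> = flip (dirac (cdf_mean \<mu>))"
proof -
  have "cdf_mean \<mu> = c" by (rule cdf_mean_const) (simp add: const)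
  with cdf_mean_bounds[of \<mu>] show ?thesis
    by (intro W1_eqI_line_cdf) (simp add: line_cdf_flip_dirac const)
qed

lemma min_eq_mult_cases:
  fixes a b :: real
  assumes "min a b = a * b"
  shows "a = 0 \<or> a = 1 \<or> b = 0 \<or> b = 1"
  using assms by (auto simp: min_def split: if_splits)

lemma mult_le_min:
  fixes a b :: real
  assumes "0 \<le> a" "a \<le> 1" "0 \<le> b" "b \<le> 1"
  shows "a * b \<le> min a b"
  using assms mult_left_le[of b a] mult_left_le_one_le[of b a] by simp

text \<open>Since \<open>min F G \<ge> F G\<close> pointwise, with equality only where one of the two is \<open>0\<close> or \<open>1\<close>,
  Chebyshev's inequality forces one of the two functions to be constant and hence the other one
  to be two-valued.\<close>

lemma cdf_dist_extremal:
  assumes d: "cdf_dist \<mu> \<nu> = cdf_mean \<mu> + cdf_mean \<nu> - 2 * (cdf_mean \<mu> * cdf_mean \<nu>)"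
    and \<mu>: "0 < cdf_mean \<mu>" "cdf_mean \<mu> < 1" and \<nu>: "0 < cdf_mean \<nu>" "cdf_mean \<nu> < 1"
  shows "\<mu> = dirac (1 - cdf_mean \<mu>) \<and> \<nu> = flip (dirac (cdf_mean \<nu>))
    \<or> \<mu> = flip (dirac (cdf_mean \<mu>)) \<and> \<nu> = dirac (1 - cdf_mean \<nu>)"
proof -
  let ?F = "line_cdf \<mu>" and ?G = "line_cdf \<nu>"
  let ?I = "\<integral>x. ?F x * ?G x \<partial>unit_lborel"
  let ?m = "\<lambda>x. min (?F x) (?G x) - ?F x * ?G x"
  have m_nonneg: "0 \<le> ?m x" for x
    using mult_le_min[of "?F x" "?G x"] by simp
  have int: "integrable unit_lborel ?m"
    by (intro Bochner_Integration.integrable_diff integrable_line_cdf)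
  have m: "(\<integral>x. ?m x \<partial>unit_lborel) = cdf_mean \<mu> * cdf_mean \<nu> - ?I"
    using d cdf_dist_eq_min[of \<mu> \<nu>] by (simp add: integrable_line_cdf)
  moreover have "0 \<le> (\<integral>x. ?m x \<partial>unit_lborel)"
    by (rule Bochner_Integration.integral_nonneg) (rule m_nonneg)
  \<comment> \<open>The hypothesis says that the integral of the minimum is the product of the
    means; it dominates \<open>?I\<close>, which Chebyshev bounds below by the same product.\<close>
  ultimately have I: "?I = cdf_mean \<mu> * cdf_mean \<nu>"
    using cdf_chebyshev(1)[of \<mu> \<nu>] by linarith
  have "AE x in unit_lborel. ?m x = 0"
    using integral_nonneg_eq_0_iff_AE[OF int] m_nonneg m I by simp
  then have "?m x = 0" if "0 \<le> x" "x < 1" for x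
    by (rule right_cont_eq_of_AE[where g = "\<lambda>_. 0"])
      (use that in \<open>auto intro!: tendsto_intros line_cdf_right_cont\<close>)
  then have two: "?F x = 0 \<or> ?F x = 1 \<or> ?G x = 0 \<or> ?G x = 1" if "0 \<le> x" "x < 1" for x
    using that by (intro min_eq_mult_cases) simp
  from cdf_chebyshev(2)[OF I] show ?thesis
  proof (elim disjE exE)
    fix c assume c: "\<forall>x. 0 \<le> x \<and> x < 1 \<longrightarrow> ?F x = c"
    then have "cdf_mean \<mu> = c" by (intro cdf_mean_const) simp
    \<comment> \<open>The constant is the mean of \<open>F\<close>, strictly between 0 and 1, so the
      alternatives for \<open>F\<close> in \<open>two\<close> drop out.\<close>
    with two c \<mu> have "?G x = 0 \<or> ?G x = 1" if "0 \<le> x" "x < 1" for x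
      using that by (metis less_irrefl)
    then have "\<nu> = dirac (1 - cdf_mean \<nu>)" by (rule eq_dirac_of_two_valued)
    moreover have "\<mu> = flip (dirac (cdf_mean \<mu>))" using c by (intro eq_flip_dirac_of_const) simp
    ultimately show ?thesis by simp
  next
    fix c assume c: "\<forall>x. 0 \<le> x \<and> x < 1 \<longrightarrow> ?G x = c"
    then have "cdf_mean \<nu> = c" by (intro cdf_mean_const) simp
    with two c \<nu> have "?F x = 0 \<or> ?F x = 1" if "0 \<le> x" "x < 1" for x
      using that by (metis less_irrefl)
    then have "\<mu> = dirac (1 - cdf_mean \<mu>)" by (rule eq_dirac_of_two_valued)
    moreover have "\<nu> = flip (dirac (cdf_mean \<nu>))" using c by (intro eq_flip_dirac_of_const) simp
    ultimately show ?thesis by simp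
  qed
qed

text \<open>The distribution function of a Dirac mass is 0 or 1, where the minimum with
  \<open>c\<close> is the product. So these pairs attain the extremal value.\<close>

lemma cdf_dist_dirac_flip_dirac:
  assumes "t \<in> {0..1}" "c \<in> {0..1}"
  shows "cdf_dist (dirac t) (flip (dirac c)) = (1 - t) + c - 2 * ((1 - t) * c)"
proof -
  have "(\<integral>x. min (line_cdf (dirac t) x) (line_cdf (flip (dirac c)) x) \<partial>unit_lborel)
      = (\<integral>x. c * line_cdf (dirac t) x \<partial>unit_lborel)"
    by (rule integral_unit_lborel_cong_interior)
      (use assms in \<open>auto simp: line_cdf_flip_dirac line_cdf_dirac\<close>)
  also have "\<dots> = c * (1 - t)"
    using cdf_mean_dirac[OF assms(1)] by (simp add: integrable_line_cdf cdf_mean_def)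
  finally show ?thesis
    using assms by (simp add: cdf_dist_eq_min cdf_mean_dirac cdf_mean_flip_dirac)
qed

text \<open>The minimum is 0 before \<open>t\<close> and \<open>F\<close> after it, so distances to
  Dirac masses encode the primitive of \<open>F\<close>.\<close>

lemma cdf_dist_dirac:
  assumes t: "t \<in> {0..1}"
  shows "cdf_dist \<mu> (dirac t)
    = 1 - t - cdf_mean \<mu> + 2 * (\<integral>x. indicator {0..<t} x * line_cdf \<mu> x \<partial>unit_lborel)"
proof -
  have int: "integrable unit_lborel (\<lambda>x. indicator {0..<t} x * line_cdf \<mu> x)"
    by (rule integrable_unit_lborel[where B = 1]) (auto simp: abs_mult indicator_def)
  have "(\<integral>x. min (line_cdf \<mu> x) (line_cdf (dirac t) x) \<partial>unit_lborel)
      = (\<integral>x. line_cdf \<mu> x - indicator {0..<t} x * line_cdf \<mu> x \<partial>unit_lborel)"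
    by (rule integral_unit_lborel_cong_interior)
      (use t in \<open>auto simp: line_cdf_dirac indicator_def min_def intro: antisym\<close>)
  also have "\<dots> = cdf_mean \<mu> - (\<integral>x. indicator {0..<t} x * line_cdf \<mu> x \<partial>unit_lborel)"
    using int by (simp add: integrable_line_cdf cdf_mean_def)
  finally show ?thesis using t by (simp add: cdf_dist_eq_min cdf_mean_dirac)
qed

lemma integral_line_cdf_between:
  assumes "0 \<le> s" "s \<le> t" "t \<le> 1"
  defines "I \<equiv> (\<lambda>\<mu> t. \<integral>x. indicator {0..<t} x * line_cdf \<mu> x \<partial>unit_lborel)"
  shows "(t - s) * line_cdf \<mu> s \<le> I \<mu> t - I \<mu> s" "I \<mu> t - I \<mu> s \<le> (t - s) * line_cdf \<mu> t"
proof -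
  have int: "integrable unit_lborel (\<lambda>x. indicator {a..<b} x * line_cdf \<mu> x)" for a b
    by (rule integrable_unit_lborel[where B = 1]) (auto simp: abs_mult indicator_def)
  have intc: "integrable unit_lborel (\<lambda>x. indicator {s..<t} x * c)" for c :: real
    by (rule integrable_unit_lborel[where B = "\<bar>c\<bar>"]) (auto simp: abs_mult indicator_def)
  have "{s..<t} \<inter> space unit_lborel = {s..<t}" using assms by (auto simp: space_unit_lborel)
  then have ic: "(\<integral>x. indicator {s..<t} x * c \<partial>unit_lborel) = (t - s) * c" for c
    using assms by (simp add: measure_unit_lborel)
  have I: "I \<mu> t - I \<mu> s = (\<integral>x. indicator {s..<t} x * line_cdf \<mu> x \<partial>unit_lborel)"
    unfolding I_def using assms
    by (subst Bochner_Integration.integral_diff[symmetric, OF int int])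
      (auto intro!: Bochner_Integration.integral_cong simp: indicator_def)
  have "(\<integral>x. indicator {s..<t} x * line_cdf \<mu> s \<partial>unit_lborel) \<le> I \<mu> t - I \<mu> s"
    unfolding I by (intro integral_mono int intc) (auto simp: indicator_def line_cdf_mono)
  then show "(t - s) * line_cdf \<mu> s \<le> I \<mu> t - I \<mu> s" by (simp only: ic)
  have "I \<mu> t - I \<mu> s \<le> (\<integral>x. indicator {s..<t} x * line_cdf \<mu> t \<partial>unit_lborel)"
    unfolding I by (intro integral_mono int intc) (auto simp: indicator_def line_cdf_mono)
  then show "I \<mu> t - I \<mu> s \<le> (t - s) * line_cdf \<mu> t" by (simp only: ic)
qed

text \<open>The case \<open>t = 1\<close> gives the mean, and then all \<open>t\<close> give the
  primitive of \<open>F\<close>, whose right derivative is \<open>F\<close> by right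
  continuity.\<close>

lemma W1_eqI_dist_dirac:
  assumes d: "\<And>t. t \<in> {0..1} \<Longrightarrow> cdf_dist \<mu> (dirac t) = cdf_dist \<nu> (dirac t)"
  shows "\<mu> = \<nu>"
proof -
  define I where "I \<mu> t = (\<integral>x. indicator {0..<t} x * line_cdf \<mu> x \<partial>unit_lborel)" for \<mu> t
  have mean: "cdf_mean \<mu> = cdf_mean \<nu>" using d[of 1] by (simp add: cdf_dist_dirac_1)
  have I: "I \<mu> t = I \<nu> t" if "t \<in> {0..1}" for t
    using d[OF that] by (simp add: cdf_dist_dirac[OF that] mean I_def)
  \<comment> \<open>Stated for arbitrary measures so that it applies in both directions.
    Monotonicity compares both difference quotients with endpoint values; then \<open>t\<close>
    tends to \<open>s\<close>.\<close>
  have le: "line_cdf \<mu> s \<le> line_cdf \<nu> s"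
    if I: "\<And>t. t \<in> {0..1} \<Longrightarrow> I \<mu> t = I \<nu> t" and s: "0 \<le> s" "s < 1" for \<mu> \<nu> s
  proof -
    have "line_cdf \<mu> s \<le> line_cdf \<nu> t" if t: "s < t" "t < 1" for t
    proof -
      have "(t - s) * line_cdf \<mu> s \<le> I \<mu> t - I \<mu> s"
        unfolding I_def using s t by (intro integral_line_cdf_between(1)) auto
      also have "\<dots> = I \<nu> t - I \<nu> s" using s t by (simp add: I)
      also have "\<dots> \<le> (t - s) * line_cdf \<nu> t"
        unfolding I_def using s t by (intro integral_line_cdf_between(2)) auto
      finally show ?thesis using t by simp
    qed
    then show ?thesis
      using s by (intro tendsto_lowerbound[OF line_cdf_right_cont])
        (auto simp: eventually_at_right_field intro!: exI[of _ 1])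
  qed
  show ?thesis
    by (rule W1_eqI_line_cdf) (intro antisym le I I[symmetric])
qed

section \<open>Rigidity and the isometry group\<close>

text \<open>An isometry fixing \<open>dirac 1\<close> preserves \<open>cdf_mean\<close>, so it sends
  the extremal pair to an extremal pair with the same means, which fix the parameters. The choice
  between the alternatives is made for both members at once.\<close>

lemma isometry_cases:
  assumes iso: "\<And>\<mu> \<nu>. cdf_dist (\<phi> \<mu>) (\<phi> \<nu>) = cdf_dist \<mu> \<nu>"
    and 0: "\<phi> (dirac 0) = dirac 0" and 1: "\<phi> (dirac 1) = dirac 1"
    and t: "t \<in> {0<..<1}" and c: "c \<in> {0<..<1}"
  shows "\<phi> (dirac t) = dirac t \<and> \<phi> (flip (dirac c)) = flip (dirac c)
    \<or> \<phi> (dirac t) = flip (dirac (1 - t)) \<and> \<phi> (flip (dirac c)) = dirac (1 - c)"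
proof -
  have mean: "cdf_mean (\<phi> \<mu>) = cdf_mean \<mu>" for \<mu>
    using iso[of \<mu> "dirac 1"] by (simp add: 1 cdf_dist_dirac_1)
  have "cdf_mean (dirac t) = 1 - t" "cdf_mean (flip (dirac c)) = c"
    using t c by (simp_all add: cdf_mean_dirac cdf_mean_flip_dirac)
  then show ?thesis
    using cdf_dist_extremal[of "\<phi> (dirac t)" "\<phi> (flip (dirac c))"] t c
    by (simp add: mean iso cdf_dist_dirac_flip_dirac)
qed

lemma flip_dirac_neq_dirac:
  assumes "c \<in> {0<..<1}" "t \<in> {0..1}"
  shows "flip (dirac c) \<noteq> dirac t"
proof
  assume "flip (dirac c) = dirac t"
  then have "line_cdf (flip (dirac c)) 0 = line_cdf (dirac t) 0" by simp
  with assms show False by (auto simp: line_cdf_flip_dirac line_cdf_dirac split: if_splits)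
qed

text \<open>The fixed mass at 1/2 forces \<open>flip (dirac (1/2))\<close> to be fixed, and this in
  turn forces every Dirac mass to be fixed.\<close>

lemma isometry_eq_id:
  assumes iso: "\<And>\<mu> \<nu>. cdf_dist (\<phi> \<mu>) (\<phi> \<nu>) = cdf_dist \<mu> \<nu>"
    and 0: "\<phi> (dirac 0) = dirac 0" and 1: "\<phi> (dirac 1) = dirac 1"
    and half: "\<phi> (dirac (1/2)) = dirac (1/2)"
  shows "\<phi> = id"
proof -
  note cases = isometry_cases[of \<phi>, OF iso 0 1]
  have kappa: "\<phi> (flip (dirac (1/2))) = flip (dirac (1/2))"
    using cases[of "1/2" "1/2"] half flip_dirac_neq_dirac[of "1/2" "1/2"] by auto
  have fix_dirac: "\<phi> (dirac t) = dirac t" if "t \<in> {0..1}" for t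
  proof (cases "t = 0 \<or> t = 1")
    case True
    then show ?thesis using 0 1 by auto
  next
    case False
    then show ?thesis
      using cases[of t "1/2"] kappa flip_dirac_neq_dirac[of "1/2" "1/2"] that by auto
  qed
  have "\<phi> \<mu> = \<mu>" for \<mu>
  proof (rule W1_eqI_dist_dirac)
    fix t :: real assume "t \<in> {0..1}"
    then show "cdf_dist (\<phi> \<mu>) (dirac t) = cdf_dist \<mu> (dirac t)"
      using iso[of \<mu> "dirac t"] by (simp add: fix_dirac)
  qed
  then show ?thesis by auto
qed

lemma isometry_fixing_endpoints:
  assumes iso: "\<And>\<mu> \<nu>. cdf_dist (\<phi> \<mu>) (\<phi> \<nu>) = cdf_dist \<mu> \<nu>"
    and 0: "\<phi> (dirac 0) = dirac 0" and 1: "\<phi> (dirac 1) = dirac 1"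
  shows "\<phi> = id \<or> \<phi> = reflection \<circ> flip"
proof (cases "\<phi> (dirac (1/2)) = dirac (1/2)")
  case True
  then show ?thesis using isometry_eq_id[of \<phi>] assms by blast
next
  case False
  then have half: "\<phi> (dirac (1/2)) = flip (dirac (1/2))"
    using isometry_cases[of \<phi> "1/2" "1/2", OF iso 0 1] by auto
  \<comment> \<open>The map \<open>reflection \<circ> flip\<close> fixes both endpoint masses and
    sends \<open>flip (dirac (1/2))\<close> back to \<open>dirac (1/2)\<close>.\<close>
  have "reflection \<circ> flip \<circ> \<phi> = id"
    by (rule isometry_eq_id)
      (simp_all add: 0 1 half iso cdf_dist_reflection cdf_dist_flip flip_dirac_0 flip_dirac_1
        flip_flip reflection_dirac)
  then have "reflection (flip (\<phi> \<mu>)) = \<mu>" for \<mu> by (metis comp_apply id_apply)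
  then have "\<phi> \<mu> = (reflection \<circ> flip) \<mu>" for \<mu>
    by (metis comp_apply flip_flip reflection_flip reflection_reflection)
  then show ?thesis by auto
qed

lemma isometric_embedding_cases:
  assumes iso: "\<And>\<mu> \<nu>. cdf_dist (\<phi> \<mu>) (\<phi> \<nu>) = cdf_dist \<mu> \<nu>"
  shows "\<phi> \<in> {id, reflection, flip, reflection \<circ> flip}"
proof -
  have "cdf_dist (\<phi> (dirac 0)) (\<phi> (dirac 1)) = 1"
    by (simp add: iso cdf_dist_dirac_1 cdf_mean_dirac)
  from cdf_dist_eq_1[OF this] show ?thesis
  proof (elim disjE conjE)
    assume "\<phi> (dirac 0) = dirac 0" "\<phi> (dirac 1) = dirac 1"
    with isometry_fixing_endpoints[of \<phi>] iso show ?thesis by auto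
  next
    assume swap: "\<phi> (dirac 0) = dirac 1" "\<phi> (dirac 1) = dirac 0"
    \<comment> \<open>Composing with the reflection undoes the swap of the endpoints; composing once
      more recovers \<open>\<phi>\<close>.\<close>
    have "reflection \<circ> \<phi> = id \<or> reflection \<circ> \<phi> = reflection \<circ> flip"
      by (rule isometry_fixing_endpoints)
        (simp_all add: swap iso cdf_dist_reflection reflection_dirac)
    moreover have "reflection \<circ> (reflection \<circ> \<phi>) = \<phi>"
      by (simp add: fun_eq_iff reflection_reflection)
    moreover have "reflection \<circ> (reflection \<circ> flip) = flip"
      by (simp add: fun_eq_iff reflection_reflection)
    ultimately have "\<phi> = reflection \<or> \<phi> = flip" by force
    then show ?thesis by blast
  qed
qed

lemma IsEmb_W1_dist: "IsEmb W1_dist = {id, reflection, flip, reflection \<circ> flip}"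
proof
  show "IsEmb W1_dist \<subseteq> {id, reflection, flip, reflection \<circ> flip}"
    using isometric_embedding_cases by (auto simp only: IsEmb_def W1_dist_eq_cdf_dist mem_Collect_eq)
  show "{id, reflection, flip, reflection \<circ> flip} \<subseteq> IsEmb W1_dist"
    by (auto simp: IsEmb_def W1_dist_eq_cdf_dist cdf_dist_reflection cdf_dist_flip)
qed

lemma surj_IsEmb_W1_dist:
  assumes "\<phi> \<in> IsEmb W1_dist"
  shows "surj \<phi>"
proof -
  have r: "surj reflection" by (rule surjI, rule reflection_reflection)
  have f: "surj flip" by (rule surjI, rule flip_flip)
  from assms show ?thesis
    unfolding IsEmb_W1_dist using r f comp_surj[OF f r] by (elim insertE emptyE) simp_all
qed

lemma Isom_W1_dist: "Isom W1_dist = IsEmb W1_dist"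
  using surj_IsEmb_W1_dist by (auto simp: Isom_def)

text \<open>Two test measures suffice: \<open>dirac 0\<close> is moved by exactly
  \<open>reflection\<close> and \<open>flip\<close>, and \<open>dirac (1/2)\<close> by exactly
  \<open>flip\<close> and \<open>reflection \<circ> flip\<close>.\<close>

lemma isometries_distinct:
  "reflection \<noteq> id" "flip \<noteq> id" "reflection \<circ> flip \<noteq> id"
  "flip \<noteq> reflection" "reflection \<circ> flip \<noteq> reflection" "reflection \<circ> flip \<noteq> flip"
proof -
  have neq: "dirac 0 \<noteq> dirac 1" "flip (dirac (1/2)) \<noteq> dirac (1/2)"
    using line_cdf_dirac[of 0 0] line_cdf_dirac[of 1 0] flip_dirac_neq_dirac[of "1/2" "1/2"] by auto
  have r: "reflection (dirac 0) = dirac 1" "reflection (dirac 1) = dirac 0" "reflection (dirac (1/2)) = dirac (1/2)"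
    by (simp_all add: reflection_dirac)
  have rf: "reflection (flip (dirac 0)) = dirac 0"
    "reflection (flip (dirac (1/2))) = flip (dirac (1/2))"
    by (simp_all add: flip_dirac_0 r reflection_flip)
  show "reflection \<noteq> id"
    by (auto simp: fun_eq_iff neq neq[symmetric] r rf flip_dirac_0 intro!: exI[of _ "dirac 0"])
  show "flip \<noteq> id"
    by (auto simp: fun_eq_iff neq neq[symmetric] r rf flip_dirac_0 intro!: exI[of _ "dirac (1/2)"])
  show "reflection \<circ> flip \<noteq> id"
    by (auto simp: fun_eq_iff neq neq[symmetric] r rf flip_dirac_0 intro!: exI[of _ "dirac (1/2)"])
  show "flip \<noteq> reflection"
    by (auto simp: fun_eq_iff neq neq[symmetric] r rf flip_dirac_0 intro!: exI[of _ "dirac (1/2)"])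
  show "reflection \<circ> flip \<noteq> reflection"
    by (auto simp: fun_eq_iff neq neq[symmetric] r rf flip_dirac_0 intro!: exI[of _ "dirac 0"])
  show "reflection \<circ> flip \<noteq> flip"
    by (auto simp: fun_eq_iff neq neq[symmetric] r rf flip_dirac_0 intro!: exI[of _ "dirac 0"])
qed

lemma isometry_group_W1_dist_iso: "isometry_group W1_dist \<cong> C2 \<times>\<times> C2"
proof -
  let ?G = "isometry_group W1_dist"
  \<comment> \<open>The pair \<open>(a, b)\<close> serves as exponents of the two generators;
    \<open>h\<close> is a homomorphism because they are commuting involutions.\<close>
  define r f where "r a = (if a = (1::int) then reflection else id)"
    and "f b = (if b = (1::int) then flip else id)" for a b
  define h where "h = (\<lambda>(a, b). r a \<circ> f b)"
  have car: "carrier (C2 \<times>\<times> C2) = {(0,0), (0,1), (1,0), (1,1)}"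
    by (auto simp: carrier_integer_mod_group)
  have carG: "carrier ?G = {id, reflection, flip, reflection \<circ> flip}"
    by (simp add: isometry_group_def Isom_W1_dist IsEmb_W1_dist)
  have vals: "h (0,0) = id" "h (0,1) = flip" "h (1,0) = reflection" "h (1,1) = reflection \<circ> flip"
    by (simp_all add: h_def r_def f_def)
  have mult: "h (x \<otimes>\<^bsub>C2 \<times>\<times> C2\<^esub> y) = h x \<otimes>\<^bsub>?G\<^esub> h y"
    if "x \<in> carrier (C2 \<times>\<times> C2)" "y \<in> carrier (C2 \<times>\<times> C2)" for x y
    using that unfolding car
    by (auto simp: vals isometry_group_def integer_mod_group_def fun_eq_iff
        reflection_reflection flip_flip reflection_flip)
  have "inj_on h (carrier (C2 \<times>\<times> C2))"
    unfolding car using isometries_distinct isometries_distinct[symmetric]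
    by (simp add: inj_on_def vals)
  moreover have "h ` carrier (C2 \<times>\<times> C2) = carrier ?G"
    unfolding car carG by (auto simp: vals)
  ultimately have "h \<in> iso (C2 \<times>\<times> C2) ?G"
    using mult by (auto simp: iso_def hom_def bij_betw_def)
  then have "C2 \<times>\<times> C2 \<cong> ?G" by (rule is_isoI)
  then show ?thesis
    by (rule group.iso_sym[OF DirProd_group[OF group_integer_mod_group group_integer_mod_group]])
qed

theorem theorem2p5:
  shows "(\<forall>\<phi> :: W1 \<Rightarrow> W1. (\<forall>\<mu> \<nu>. W1_dist (\<phi> \<mu>) (\<phi> \<nu>) = W1_dist \<mu> \<nu>) \<longrightarrow>
             \<phi> \<in> {id, reflection, flip, reflection \<circ> flip})
    \<and> reflection \<circ> flip = flip \<circ> reflection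
    \<and> (\<forall>\<phi> \<in> IsEmb W1_dist. surj \<phi>)
    \<and> IsEmb W1_dist = Isom W1_dist
    \<and> isometry_group W1_dist \<cong> C2 \<times>\<times> C2"
proof (intro conjI)
  show "\<forall>\<phi> :: W1 \<Rightarrow> W1. (\<forall>\<mu> \<nu>. W1_dist (\<phi> \<mu>) (\<phi> \<nu>) = W1_dist \<mu> \<nu>) \<longrightarrow>
             \<phi> \<in> {id, reflection, flip, reflection \<circ> flip}"
    unfolding W1_dist_eq_cdf_dist using isometric_embedding_cases by blast
  show "reflection \<circ> flip = flip \<circ> reflection"
    by (simp add: fun_eq_iff reflection_flip)
qed (simp_all add: surj_IsEmb_W1_dist Isom_W1_dist isometry_group_W1_dist_iso)

end
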